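(* There exists an absolute constant $c>0$ such that the following holds. Let $\Delta\colon\mathbb{N}\to\mathbb{R}^+$ satisfy $\Delta(n)\ge\log n$. Then the binomial random graph $G(n,p)$ is asymptotically almost surely universal for $\mathcal{T}(n,\Delta)$, provided that $pn\ge c\,\Delta\, n^{2/3}\log n$.
   Context: $G(n,p)$ is the random graph on $n$ vertices in which each pair of vertices is an edge independently with probability $p$. "Asymptotically almost surely" (a.a.s.) means with probability tending to $1$ as $n\to\infty$. $\mathcal{T}(n,\Delta)$ is the class of all $n$-vertex trees with maximum degree at most $\Delta$; a graph is universal for a class if it contains a copy (as a subgraph) of every member of the class. $\log$ is the natural logarithm. *)

theory Defs
  imports "HOL-Probability.Probability"
begin

text \<open>Simple graphs: a vertex set together with a set of two-element sets of vertices.\<close>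

type_synonym 'a sgraph = "'a set \<times> 'a set set"

abbreviation verts :: "'a sgraph \<Rightarrow> 'a set" where
  "verts G \<equiv> fst G"

abbreviation edges :: "'a sgraph \<Rightarrow> 'a set set" where
  "edges G \<equiv> snd G"

definition all_pairs :: "'a set \<Rightarrow> 'a set set" where
  "all_pairs V = {e. e \<subseteq> V \<and> card e = 2}"

definition finite_sgraph :: "'a sgraph \<Rightarrow> bool" where
  "finite_sgraph G \<longleftrightarrow> finite (verts G) \<and> edges G \<subseteq> all_pairs (verts G)"

definition degree :: "'a sgraph \<Rightarrow> 'a \<Rightarrow> nat" where
  "degree G v = card {u. {v, u} \<in> edges G}"

text \<open>Only meaningful for graphs with a nonempty finite vertex set.\<close>

definition max_degree :: "'a sgraph \<Rightarrow> nat" where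
  "max_degree G = Max (degree G ` verts G)"

definition connected_sgraph :: "'a sgraph \<Rightarrow> bool" where
  "connected_sgraph G \<longleftrightarrow> verts G \<noteq> {} \<and>
     (\<forall>u\<in>verts G. \<forall>v\<in>verts G. (u, v) \<in> {(x, y). {x, y} \<in> edges G}\<^sup>*)"

text \<open>A cycle is listed by its distinct vertices, of which there are at least three; the
  index is taken modulo the length to include the closing edge.\<close>

definition is_cycle :: "'a sgraph \<Rightarrow> 'a list \<Rightarrow> bool" where
  "is_cycle G xs \<longleftrightarrow> length xs \<ge> 3 \<and> distinct xs \<and>
     (\<forall>i<length xs. {xs ! i, xs ! (Suc i mod length xs)} \<in> edges G)"

definition is_tree :: "'a sgraph \<Rightarrow> bool" where
  "is_tree G \<longleftrightarrow> finite_sgraph G \<and> connected_sgraph G \<and> (\<nexists>xs. is_cycle G xs)"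

text \<open>The vertices are natural numbers, but the vertex set is an arbitrary set of \<open>n\<close> of them,
  so every isomorphism type of trees on \<open>n\<close> vertices is represented.\<close>

definition bounded_trees :: "nat \<Rightarrow> real \<Rightarrow> nat sgraph set" where
  "bounded_trees n \<Delta> = {T. is_tree T \<and> card (verts T) = n \<and> real (max_degree T) \<le> \<Delta>}"

text \<open>Copies are subgraphs, not necessarily induced.\<close>

definition contains_copy :: "'a sgraph \<Rightarrow> 'b sgraph \<Rightarrow> bool" where
  "contains_copy G H \<longleftrightarrow> (\<exists>f. inj_on f (verts H) \<and> f ` verts H \<subseteq> verts G \<and>
     (\<forall>e\<in>edges H. f ` e \<in> edges G))"

definition universal_for :: "'a sgraph \<Rightarrow> 'b sgraph set \<Rightarrow> bool" where
  "universal_for G \<H> \<longleftrightarrow> (\<forall>H\<in>\<H>. contains_copy G H)"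

text \<open>The binomial random graph on the vertex set \<open>{..<n}\<close>. Note that \<^const>\<open>bernoulli_pmf\<close>
  truncates its parameter to the unit interval.\<close>

definition random_graph :: "nat \<Rightarrow> real \<Rightarrow> nat sgraph pmf" where
  "random_graph n p =
     map_pmf (\<lambda>b. ({..<n}, {e \<in> all_pairs {..<n}. b e}))
       (Pi_pmf (all_pairs {..<n}) False (\<lambda>_. bernoulli_pmf p))"

text \<open>A sequence of events, the \<open>n\<close>-th one in the probability space \<open>M n\<close>, holds asymptotically
  almost surely.\<close>

definition asymptotically_almost_surely :: "(nat \<Rightarrow> 'a pmf) \<Rightarrow> (nat \<Rightarrow> 'a \<Rightarrow> bool) \<Rightarrow> bool" where
  "asymptotically_almost_surely M P \<longleftrightarrow>
     (\<lambda>n. measure_pmf.prob (M n) {x. P n x}) \<longlonglongrightarrow> 1"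

end

theory Submission
  imports Defs "HOL-Real_Asymp.Real_Asymp"
begin

text \<open>Every tree \<open>T\<close> of maximum degree at most \<open>D\<close> has \<open>t \<approx> n / (20 D)\<close> vertices (the slots) that are
  leaves with distinct parents or midpoints of disjoint bare paths. Delete the slots and embed the
  remaining forest greedily, parents first, into a graph in which any two sets of size
  \<open>m \<approx> log n / p\<close> span an edge. At any time fewer than \<open>m\<close> vertices see no free vertex of a given
  target set; free sets shrink, so these bad vertices accumulate monotonically, and only \<open>O(D m)\<close>
  children have to be placed in a reserve \<open>R\<close>, where every vertex has more neighbours than that.

  The target sets are chosen so that nearly all neighbourhoods of slots become members of a family of
  disjoint pairs that was fixed before the graph was drawn. Then Hall's condition between the slots
  and the unused vertices follows from three properties of \<open>G(n,p)\<close> that survive a union bound: a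
  small set of vertices covers far more designated pairs than it has elements, a small set of slots
  is covered by far more vertices of \<open>R\<close>, and some vertex of a large set covers some slot of a large
  set. The designated pairs and \<open>R\<close> outweigh the
  exceptions since \<open>p\<^sup>2 n / D\<close> exceeds \<open>D m log n\<close>, which holds for \<open>p \<ge> D n\<^sup>-\<^sup>1\<^sup>/\<^sup>3 log n\<close>.\<close>

section \<open>Hall's marriage theorem\<close>

text \<open>The pairs of images around the slots depend on the graph through the greedy embedding,
  so a union bound has to admit every family of pairs that could arise. For few vertices
  \<open>Y\<close> against about t pairs this is hopeless: there are up to n^(2t) families, while a
  single one stays uncovered with probability about exp(-p^2 t |Y|), and p^2 |Y| may be far below
  log n. For pairs (a, \<open>\<beta>\<close> a) fixed beforehand, only the omitted ones have to be
  chosen, in n^(2|Y| + q) ways with q of order D m; the same holds for \<open>R\<close>. Fixing them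
  is possible because the child of a slot has no embedded neighbour when it is placed: its only
  earlier neighbour is the deleted slot. So it is free to go to the partner of its grandparent's
  image. The graph is never exposed in rounds: \<open>pair_expander\<close> lists deterministic
  properties, and all that is done with the tree afterwards is deterministic.\<close>

lemma hall_marriage:
  fixes N :: "'a \<Rightarrow> 'b set"
  assumes "finite S" "\<And>s. s \<in> S \<Longrightarrow> finite (N s)"
    and "\<And>J. J \<subseteq> S \<Longrightarrow> card J \<le> card (\<Union> (N ` J))"
  shows "\<exists>f. inj_on f S \<and> (\<forall>s\<in>S. f s \<in> N s)"
  using assms
proof (induction "card S" arbitrary: S N rule: less_induct)
  case less
  note fin = less.prems(1) and finN = less.prems(2) and hall = less.prems(3)
  have finU: "finite (\<Union> (N ` J))" if "J \<subseteq> S" for J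
    using that fin finN finite_subset by (metis finite_UN_I subsetD)
  show ?case
  proof (cases "S = {}")
    case False
    show ?thesis
    proof (cases "\<exists>J. J \<subseteq> S \<and> J \<noteq> {} \<and> J \<noteq> S \<and> card (\<Union> (N ` J)) \<le> card J")
      \<comment> \<open>A tight proper subset \<open>J\<close> is matched on its own. Deleting its
        neighbours preserves Hall's condition on the rest, since the condition held for unions with
        \<open>J\<close>.\<close>
      case True
      then obtain J where J: "J \<subseteq> S" "J \<noteq> {}" "J \<noteq> S" "card (\<Union> (N ` J)) \<le> card J" by blast
      have finJ: "finite J" using J fin finite_subset by blast
      have "card J < card S" using J fin by (simp add: psubset_card_mono psubsetI)
      then obtain f where f: "inj_on f J" "\<forall>s\<in>J. f s \<in> N s"
        using less.hyps[of J N] finJ finN hall J(1) by (meson subsetD order_trans)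
      define N' where "N' = (\<lambda>s. N s - \<Union> (N ` J))"
      have "card (S - J) < card S"
        using J fin by (intro psubset_card_mono) auto
      moreover have "card K \<le> card (\<Union> (N' ` K))" if K: "K \<subseteq> S - J" for K
      proof -
        have "card K + card J = card (K \<union> J)"
          using K finJ fin by (subst card_Un_disjoint) (auto intro: finite_subset)
        also have "\<dots> \<le> card (\<Union> (N ` (K \<union> J)))" using hall K J(1) by blast
        also have "\<Union> (N ` (K \<union> J)) = \<Union> (N' ` K) \<union> \<Union> (N ` J)" by (auto simp: N'_def)
        also have "card \<dots> \<le> card (\<Union> (N' ` K)) + card (\<Union> (N ` J))" by (rule card_Un_le)
        finally show ?thesis using J(4) by linarith
      qed
      ultimately obtain g where g: "inj_on g (S - J)" "\<forall>s\<in>S - J. g s \<in> N' s"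
        using less.hyps[of "S - J" N'] fin finN by (auto simp: N'_def)
      have "f ` J \<inter> g ` (S - J) = {}" using f(2) g(2) by (auto simp: N'_def)
      then have "inj_on (\<lambda>s. if s \<in> J then f s else g s) (J \<union> (S - J))"
        by (rule inj_on_disjoint_Un[OF f(1) g(1)])
      then have "inj_on (\<lambda>s. if s \<in> J then f s else g s) S"
        using J(1) by (simp add: Un_absorb1)
      then show ?thesis using f g unfolding N'_def
        by (intro exI[of _ "\<lambda>s. if s \<in> J then f s else g s"]) auto
    next
      \<comment> \<open>Every proper nonempty subset has a neighbour to spare, so an arbitrary first
        match does no harm.\<close>
      case False
      obtain s where s: "s \<in> S" using \<open>S \<noteq> {}\<close> by blast
      have "card {s} \<le> card (N s)" using hall[of "{s}"] s by simp
      then obtain x where x: "x \<in> N s" by (cases "N s = {}") auto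
      define N' where "N' = (\<lambda>u. N u - {x})"
      have "card (S - {s}) < card S" using s fin by (meson card_Diff1_less)
      moreover have "card K \<le> card (\<Union> (N' ` K))" if K: "K \<subseteq> S - {s}" for K
      proof (cases "K = {}")
        case nonempty: False
        have "K \<subseteq> S" "K \<noteq> S" using K s by auto
        then have "card K < card (\<Union> (N ` K))" using False nonempty by (meson not_le)
        also have "\<dots> \<le> card (insert x (\<Union> (N' ` K)))"
          using finU[of K] \<open>K \<subseteq> S\<close> by (intro card_mono) (auto simp: N'_def intro: finite_subset)
        also have "\<dots> \<le> Suc (card (\<Union> (N' ` K)))" by (rule card_insert_le_m1) auto
        finally show ?thesis by simp
      qed simp
      ultimately obtain g where g: "inj_on g (S - {s})" "\<forall>u\<in>S - {s}. g u \<in> N' u"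
        using less.hyps[of "S - {s}" N'] fin finN by (auto simp: N'_def)
      have "inj_on (g(s := x)) S"
        using g by (auto simp: inj_on_def N'_def)
      then show ?thesis using g x unfolding N'_def
        by (intro exI[of _ "g(s := x)"]) auto
    qed
  qed auto
qed

section \<open>Trees as parent arrays\<close>

lemma rtrancl_distinct_path:
  assumes "(x, y) \<in> r\<^sup>*"
  obtains xs where "distinct xs" "xs \<noteq> []" "hd xs = x" "last xs = y"
    "successively (\<lambda>a b. (a, b) \<in> r) xs"
proof -
  have "\<exists>xs. distinct xs \<and> xs \<noteq> [] \<and> hd xs = x \<and> last xs = y \<and> successively (\<lambda>a b. (a, b) \<in> r) xs"
    using assms
  proof (induction rule: converse_rtrancl_induct)
    case base
    show ?case by (intro exI[of _ "[y]"]) auto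
  next
    case (step x x')
    then obtain xs where xs: "distinct xs" "xs \<noteq> []" "hd xs = x'" "last xs = y"
      "successively (\<lambda>a b. (a, b) \<in> r) xs" by blast
    show ?case
    proof (cases "x \<in> set xs")
      case False
      then show ?thesis using xs step(1)
        by (intro exI[of _ "x # xs"]) (auto simp: successively_Cons)
    next
      \<comment> \<open>The new start already lies on the path: cut out the detour.\<close>
      case True
      then obtain ys zs where "xs = ys @ x # zs" by (meson split_list)
      then show ?thesis using xs
        by (intro exI[of _ "x # zs"]) (auto simp: successively_append_iff)
    qed
  qed
  then show ?thesis using that by blast
qed

lemma is_cycle_append_vertex:
  assumes "distinct xs" "length xs \<ge> 2" "v \<notin> set xs"
    and "successively (\<lambda>a b. {a, b} \<in> edges G) xs" "{last xs, v} \<in> edges G" "{v, hd xs} \<in> edges G"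
  shows "is_cycle G (xs @ [v])"
  unfolding is_cycle_def
proof (intro conjI allI impI)
  fix i assume i: "i < length (xs @ [v])"
  have "Suc i < length xs \<or> Suc i = length xs \<or> i = length xs" using i by (simp; linarith)
  then consider "Suc i < length xs" | "Suc i = length xs" | "i = length xs" by blast
  then show "{(xs @ [v]) ! i, (xs @ [v]) ! (Suc i mod length (xs @ [v]))} \<in> edges G"
  proof cases
    case 1
    then have "{xs ! i, xs ! Suc i} \<in> edges G" using assms(4) by (simp add: successively_conv_nth)
    then show ?thesis using 1 by (simp add: nth_append)
  next
    case 2
    then have "i = length xs - 1" "xs \<noteq> []" using assms(2) by auto
    then have "xs ! i = last xs" by (simp add: last_conv_nth)
    then show ?thesis using 2 assms(5) by (simp add: nth_append)
  next
    case 3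
    have "xs \<noteq> []" using assms(2) by auto
    then have "xs ! 0 = hd xs" by (simp add: hd_conv_nth)
    then show ?thesis using 3 \<open>xs \<noteq> []\<close> assms(6) by (simp add: nth_append)
  qed
next
  show "3 \<le> length (xs @ [v])" using assms(2) by simp
next
  show "distinct (xs @ [v])" using assms(1,3) by simp
qed

text \<open>A path from \<open>u\<close> to \<open>u'\<close> inside \<open>U\<close> avoids
  \<open>v\<close>, so two distinct neighbours of \<open>v\<close> would close it to a cycle. This
  is why reachability is restricted to \<open>U\<close>.\<close>

lemma tree_unique_neighbour:
  assumes T: "is_tree T" and U: "\<forall>x\<in>U. \<forall>y\<in>U. (x, y) \<in> {(x, y). {x, y} \<in> edges T \<and> x \<in> U \<and> y \<in> U}\<^sup>*"
    and "v \<notin> U" "u \<in> U" "u' \<in> U" "{u, v} \<in> edges T" "{u', v} \<in> edges T"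
  shows "u = u'"
proof (rule ccontr)
  assume ne: "u \<noteq> u'"
  obtain xs where xs: "distinct xs" "xs \<noteq> []" "hd xs = u" "last xs = u'"
    "successively (\<lambda>a b. (a, b) \<in> {(x, y). {x, y} \<in> edges T \<and> x \<in> U \<and> y \<in> U}) xs"
    using rtrancl_distinct_path[OF bspec[OF bspec[OF U \<open>u \<in> U\<close>] \<open>u' \<in> U\<close>]] by blast
  have len: "length xs \<ge> 2"
  proof (rule ccontr)
    assume "\<not> length xs \<ge> 2"
    then have "xs = [hd xs]" using xs(2) by (cases xs) (auto simp: Suc_le_eq)
    then have "last xs = hd xs" by (metis last.simps)
    then show False using xs ne by simp
  qed
  have "x \<in> U" if "x \<in> set xs" for x
  proof -
    obtain i where i: "i < length xs" "xs ! i = x" using \<open>x \<in> set xs\<close> by (meson in_set_conv_nth)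
    show ?thesis
    proof (cases "Suc i < length xs")
      case True
      then show ?thesis using xs(5) i by (auto simp: successively_conv_nth)
    next
      case False
      then have "i = length xs - 1" using i by linarith
      then have "x = last xs" using i xs(2) by (simp add: last_conv_nth)
      then show ?thesis using xs \<open>u' \<in> U\<close> by simp
    qed
  qed
  moreover have "successively (\<lambda>a b. {a, b} \<in> edges T) xs"
    using xs(5) by (rule successively_mono) auto
  ultimately have "is_cycle T (xs @ [v])"
    using assms xs len by (intro is_cycle_append_vertex) (auto simp: insert_commute)
  then show False using T by (auto simp: is_tree_def)
qed

lemma rtrancl_crossing:
  assumes "(a, b) \<in> r\<^sup>*" "a \<in> U" "b \<notin> U"
  shows "\<exists>x y. (x, y) \<in> r \<and> x \<in> U \<and> y \<notin> U"
  using assms by (induction rule: rtrancl_induct) auto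

lemma parent_array_connected:
  fixes g :: "nat \<Rightarrow> 'a"
  assumes "\<forall>i\<in>{1..<k}. par i < i" "\<forall>i\<in>{1..<k}. {g i, g (par i)} \<in> E"
  shows "\<forall>x\<in>g ` {..<k}. \<forall>y\<in>g ` {..<k}.
    (x, y) \<in> {(x, y). {x, y} \<in> E \<and> x \<in> g ` {..<k} \<and> y \<in> g ` {..<k}}\<^sup>*"
proof -
  let ?r = "{(x, y). {x, y} \<in> E \<and> x \<in> g ` {..<k} \<and> y \<in> g ` {..<k}}"
  have sym: "sym (?r\<^sup>*)" by (intro sym_rtrancl) (auto simp: sym_def insert_commute)
  have root: "(g i, g 0) \<in> ?r\<^sup>*" if "i < k" for i
    using that
  proof (induction i rule: less_induct)
    case (less i)
    show ?case
    proof (cases "i = 0")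
      case False
      then have i: "i \<in> {1..<k}" using less.prems by auto
      then have "par i < k" "{g i, g (par i)} \<in> E" using assms by fastforce+
      then have "(g i, g (par i)) \<in> ?r" using less.prems by auto
      moreover have "(g (par i), g 0) \<in> ?r\<^sup>*" using less i assms by force
      ultimately show ?thesis by (rule converse_rtrancl_into_rtrancl)
    qed simp
  qed
  show ?thesis
  proof (intro ballI)
    fix x y assume "x \<in> g ` {..<k}" "y \<in> g ` {..<k}"
    then obtain i j where "x = g i" "y = g j" "i < k" "j < k" by auto
    then show "(x, y) \<in> ?r\<^sup>*" using root[of i] root[of j] symD[OF sym] by (meson rtrancl_trans)
  qed
qed

text \<open>A connected vertex set is grown one vertex at a time, with the invariant that the edges
  inside the first \<open>k\<close> vertices are exactly the parent edges. By
  \<open>tree_unique_neighbour\<close> a new vertex contributes a single edge.\<close>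

lemma tree_parent_array:
  assumes T: "is_tree T"
  defines "n \<equiv> card (verts T)"
  obtains g :: "nat \<Rightarrow> 'a" and par where "bij_betw g {..<n} (verts T)" "\<forall>i\<in>{1..<n}. par i < i"
    "edges T = (\<lambda>i. {g i, g (par i)}) ` {1..<n}"
proof -
  have fin: "finite (verts T)" and sub: "edges T \<subseteq> all_pairs (verts T)"
    and ne: "verts T \<noteq> {}" and conn: "\<And>u v. u \<in> verts T \<Longrightarrow> v \<in> verts T \<Longrightarrow> (u, v) \<in> {(x, y). {x, y} \<in> edges T}\<^sup>*"
    using T by (auto simp: is_tree_def finite_sgraph_def connected_sgraph_def)
  have n: "n \<ge> 1" using fin ne by (simp add: n_def Suc_le_eq card_gt_0_iff)
  have "\<exists>g par. inj_on g {..<k} \<and> g ` {..<k} \<subseteq> verts T \<and> (\<forall>i\<in>{1..<k}. par i < i) \<and>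
      {e \<in> edges T. e \<subseteq> g ` {..<k}} = (\<lambda>i. {g i, g (par i)}) ` {1..<k}"
    if "1 \<le> k" "k \<le> n" for k
    using that
  proof (induction k rule: nat_induct_at_least)
    case base
    obtain v where v: "v \<in> verts T" using ne by blast
    have "{e \<in> edges T. e \<subseteq> {v}} = {}"
      using sub by (auto simp: all_pairs_def subset_singleton_iff)
    then show ?case using v by (intro exI[of _ "\<lambda>_. v"] exI) (auto simp: lessThan_Suc)
  next
    case (Suc k)
    then obtain g :: "nat \<Rightarrow> 'a" and par where g: "inj_on g {..<k}" "g ` {..<k} \<subseteq> verts T" "\<forall>i\<in>{1..<k}. par i < i"
      and E: "{e \<in> edges T. e \<subseteq> g ` {..<k}} = (\<lambda>i. {g i, g (par i)}) ` {1..<k}" by auto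
    define U where "U = g ` {..<k}"
    have "card U = k" unfolding U_def using g(1) by (simp add: card_image)
    then have "U \<noteq> verts T" using Suc.prems by (auto simp: n_def)
    then obtain b where b: "b \<in> verts T" "b \<notin> U" using g(2) U_def by blast
    have g0: "g 0 \<in> U" using Suc.hyps by (auto simp: U_def)
    moreover have "g 0 \<in> verts T" using g0 g(2) by (auto simp: U_def)
    ultimately have "\<exists>x y. (x, y) \<in> {(x, y). {x, y} \<in> edges T} \<and> x \<in> U \<and> y \<notin> U"
      by (intro rtrancl_crossing[OF conn]) (use b in auto)
    then obtain x v where xv: "{x, v} \<in> edges T" "x \<in> U" "v \<notin> U" by auto
    then obtain i0 where i0: "i0 < k" "x = g i0" by (auto simp: U_def)
    have vT: "v \<in> verts T" using xv(1) sub by (auto simp: all_pairs_def)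
    have "\<forall>i\<in>{1..<k}. {g i, g (par i)} \<in> edges T" using E by blast
    then have con: "\<forall>x\<in>U. \<forall>y\<in>U. (x, y) \<in> {(x, y). {x, y} \<in> edges T \<and> x \<in> U \<and> y \<in> U}\<^sup>*"
      unfolding U_def by (intro parent_array_connected[OF g(3)])
    define g' where "g' = g(k := v)"
    define par' where "par' = par(k := i0)"
    have g'U: "g' ` {..<Suc k} = insert v U" by (auto simp: g'_def U_def lessThan_Suc)
    have "inj_on g' {..<Suc k}" using g(1) xv(3)
      by (auto simp: g'_def U_def lessThan_Suc inj_on_def)
    moreover have "g' ` {..<Suc k} \<subseteq> verts T" using g'U vT g(2) U_def by auto
    moreover have "\<forall>i\<in>{1..<Suc k}. par' i < i" using g(3) i0 by (auto simp: par'_def)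
    moreover have "{e \<in> edges T. e \<subseteq> g' ` {..<Suc k}} = (\<lambda>i. {g' i, g' (par' i)}) ` {1..<Suc k}"
    proof -
      have "{e \<in> edges T. e \<subseteq> insert v U} = insert {v, x} {e \<in> edges T. e \<subseteq> U}"
      proof (intro equalityI subsetI)
        fix e assume e: "e \<in> {e \<in> edges T. e \<subseteq> insert v U}"
        show "e \<in> insert {v, x} {e \<in> edges T. e \<subseteq> U}"
        proof (cases "v \<in> e")
          case True
          have "card e = 2" using e sub by (auto simp: all_pairs_def)
          then obtain y where y: "e = {v, y}" "y \<noteq> v" using True by (metis card_2_iff insertE insert_commute singletonD)
          then have "y \<in> U" using e by auto
          then have "x = y" using tree_unique_neighbour[OF T con xv(3) xv(2) _ xv(1)] e y
            by (auto simp: insert_commute)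
          then show ?thesis using y by simp
        qed (use e in auto)
      qed (use xv in \<open>auto simp: insert_commute\<close>)
      also have "\<dots> = insert {v, x} ((\<lambda>i. {g i, g (par i)}) ` {1..<k})" using E U_def by simp
      also have "(\<lambda>i. {g i, g (par i)}) ` {1..<k} = (\<lambda>i. {g' i, g' (par' i)}) ` {1..<k}"
      proof (intro image_cong refl)
        fix i assume "i \<in> {1..<k}"
        then have "i < k" "par i < k" using g(3) by fastforce+
        then show "{g i, g (par i)} = {g' i, g' (par' i)}" by (simp add: g'_def par'_def)
      qed
      also have "insert {v, x} \<dots> = (\<lambda>i. {g' i, g' (par' i)}) ` {1..<Suc k}"
        using Suc.hyps i0 by (auto simp: atLeastLessThanSuc g'_def par'_def)
      finally show ?thesis using g'U by simp
    qed
    ultimately show ?case by blast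
  qed
  from this[OF n order_refl] obtain g :: "nat \<Rightarrow> 'a" and par where g: "inj_on g {..<n}" "g ` {..<n} \<subseteq> verts T" "\<forall>i\<in>{1..<n}. par i < i"
    and E: "{e \<in> edges T. e \<subseteq> g ` {..<n}} = (\<lambda>i. {g i, g (par i)}) ` {1..<n}" by auto
  have im: "g ` {..<n} = verts T"
    using g fin by (intro card_subset_eq) (auto simp: card_image n_def)
  then have "{e \<in> edges T. e \<subseteq> g ` {..<n}} = edges T" using sub by (auto simp: all_pairs_def)
  then show ?thesis using that g E im by (simp add: bij_betw_def)
qed

section \<open>Leaves and bare paths\<close>

text \<open>Index 0 is the root; starting the range at 1 ignores the meaningless value
  \<open>par 0\<close>.\<close>

definition children :: "nat \<Rightarrow> (nat \<Rightarrow> nat) \<Rightarrow> nat \<Rightarrow> nat set" where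
  "children n par i = {j \<in> {1..<n}. par j = i}"

lemma finite_children [simp]: "finite (children n par i)"
  by (simp add: children_def)

lemma parent_array_depth:
  assumes "\<forall>i\<in>{1..<n}. par i < (i::nat)"
  obtains dep :: "nat \<Rightarrow> nat" where "\<forall>i\<in>{1..<n}. dep i = Suc (dep (par i))"
proof -
  have "\<exists>dep :: nat \<Rightarrow> nat. \<forall>i\<in>{1..<k}. dep i = Suc (dep (par i))" if "k \<le> n" for k
    using that
  proof (induction k)
    case (Suc k)
    then obtain dep :: "nat \<Rightarrow> nat" where dep: "\<forall>i\<in>{1..<k}. dep i = Suc (dep (par i))" by auto
    have "par i < i" if "i \<in> {1..<Suc k}" for i using assms that Suc.prems by auto
    then have "\<forall>i\<in>{1..<Suc k}. (dep(k := Suc (dep (par k)))) i = Suc ((dep(k := Suc (dep (par k)))) (par i))"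
      using dep by (force simp: less_Suc_eq)
    then show ?case by blast
  qed auto
  then show ?thesis using that by blast
qed

lemma sum_card_children:
  assumes "\<forall>i\<in>{1..<n}. par i < i"
  shows "(\<Sum>i<n. card (children n par i)) = n - 1"
proof -
  have "(\<Union>i\<in>{..<n}. children n par i) = {1..<n}"
    using assms by (fastforce simp: children_def)
  moreover have "card (\<Union>i\<in>{..<n}. children n par i) = (\<Sum>i<n. card (children n par i))"
    by (intro card_UN_disjoint) (auto simp: children_def)
  ultimately show ?thesis by simp
qed

lemma card_children_UN_le:
  assumes "\<forall>i<n. card (children n par i) \<le> D" "X \<subseteq> {..<n}"
  shows "card (\<Union>i\<in>X. children n par i) \<le> D * card X"
proof -
  have fin: "finite X" using assms(2) finite_subset by blast
  have "card (\<Union>i\<in>X. children n par i) \<le> (\<Sum>i\<in>X. card (children n par i))"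
    by (rule card_UN_le[OF fin])
  also have "\<dots> \<le> (\<Sum>i\<in>X. D)" using assms by (intro sum_mono) auto
  finally show ?thesis by (simp add: mult.commute)
qed

text \<open>If leaves are scarce, then almost every vertex has exactly one child, hence so does its
  parent; restricting the depth modulo 3 makes the resulting bare paths disjoint.\<close>

lemma bare_path_midpoints:
  assumes par: "\<forall>i\<in>{1..<n}. par i < i" and n: "n \<ge> 2"
  defines "Z \<equiv> {i \<in> {..<n}. children n par i = {}}"
    and "M \<equiv> {s \<in> {1..<n}. card (children n par s) = 1 \<and> card (children n par (par s)) = 1 \<and> par s \<noteq> 0}"
  shows "n \<le> card M + 4 * card Z + 2"
proof -
  let ?c = "\<lambda>i. card (children n par i)"
  define Q where "Q = {i \<in> {..<n}. ?c i = 1}"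
  define H where "H = {i \<in> {..<n}. ?c i \<ge> 2}"
  have fin: "finite Z" "finite Q" "finite H" "finite M" by (auto simp: Z_def Q_def H_def M_def)
  have split: "{..<n} = Z \<union> (Q \<union> H)"
  proof -
    have "i \<in> Z \<union> (Q \<union> H)" if "i < n" for i
    proof -
      have "?c i = 0 \<or> ?c i = 1 \<or> ?c i \<ge> 2" by linarith
      then show ?thesis using that by (auto simp: Z_def Q_def H_def)
    qed
    then show ?thesis by (auto simp: Z_def Q_def H_def)
  qed
  have disj: "Z \<inter> (Q \<union> H) = {}" "Q \<inter> H = {}" by (auto simp: Z_def Q_def H_def)
  have "n = card Z + (card Q + card H)"
    using arg_cong[OF split, of card] fin disj by (simp add: card_Un_disjoint)
  moreover have "n - 1 = sum ?c H + card Q"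
  proof -
    have "n - 1 = (\<Sum>i\<in>Z \<union> (Q \<union> H). ?c i)"
      using sum_card_children[OF par] split by simp
    also have "\<dots> = sum ?c Z + (sum ?c Q + sum ?c H)"
      using fin disj by (simp add: sum.union_disjoint)
    also have "sum ?c Z = 0" by (simp add: Z_def)
    also have "sum ?c Q = card Q" by (simp add: Q_def)
    finally show ?thesis by simp
  qed
  moreover have "sum ?c H \<ge> 2 * card H"
    using sum_bounded_below[of H 2 ?c] by (simp add: H_def mult.commute)
  \<comment> \<open>Comparing the two counts gives \<open>sum ?c H = card Z + card H - 1\<close>. As
    this is at least \<open>2 * card H\<close>, there are fewer branching vertices than
    leaves.\<close>
  ultimately have H: "sum ?c H \<le> 2 * card Z" "n \<le> card Q + 2 * card Z"
    using n by linarith+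
  \<comment> \<open>A non-root vertex with one child fails to be a midpoint only below a branching
    vertex or as the only child of the root.\<close>
  have "{s \<in> Q. s \<noteq> 0} \<subseteq> M \<union> (\<Union>i\<in>H. children n par i) \<union> {s \<in> children n par 0. ?c 0 = 1}"
  proof
    fix s assume s: "s \<in> {s \<in> Q. s \<noteq> 0}"
    then have sn: "s \<in> {1..<n}" by (auto simp: Q_def)
    then have "par s < s" using par by blast
    with sn have ps: "par s < n" "s \<in> children n par (par s)" by (auto simp: children_def)
    then have "par s \<notin> Z" by (auto simp: Z_def)
    then consider "par s \<in> H" | "par s \<in> Q" using split ps by blast
    then show "s \<in> M \<union> (\<Union>i\<in>H. children n par i) \<union> {s \<in> children n par 0. ?c 0 = 1}"
    proof cases
      case 2
      then show ?thesis using s sn ps by (cases "par s = 0") (auto simp: Q_def M_def)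
    qed (use ps in blast)
  qed
  then have "card {s \<in> Q. s \<noteq> 0}
      \<le> card (M \<union> (\<Union>i\<in>H. children n par i) \<union> {s \<in> children n par 0. ?c 0 = 1})"
    using fin by (intro card_mono) auto
  also have "\<dots> \<le> card M + card (\<Union>i\<in>H. children n par i) + card {s \<in> children n par 0. ?c 0 = 1}"
    by (meson add_mono card_Un_le le_trans order_refl)
  also have "card (\<Union>i\<in>H. children n par i) \<le> sum ?c H" using fin by (intro card_UN_le) auto
  also have "card {s \<in> children n par 0. ?c 0 = 1} \<le> 1" by (cases "?c 0 = 1") auto
  finally have "card {s \<in> Q. s \<noteq> 0} \<le> card M + 2 * card Z + 1" using H by linarith
  moreover have "card Q \<le> card {s \<in> Q. s \<noteq> 0} + 1"
  proof -
    have "Q \<subseteq> insert 0 {s \<in> Q. s \<noteq> 0}" by auto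
    then have "card Q \<le> card (insert 0 {s \<in> Q. s \<noteq> 0})" using fin by (intro card_mono) auto
    then show ?thesis using card_insert_le_m1[of "card {s \<in> Q. s \<noteq> 0} + 1" "{s \<in> Q. s \<noteq> 0}" 0] by simp
  qed
  ultimately show ?thesis using H by linarith
qed

text \<open>Either the leaves have more than \<open>t\<close> distinct parents, and one leaf is kept
  for each of \<open>t\<close> of them; or there are at most \<open>D * t\<close> leaves, and
  \<open>bare_path_midpoints\<close> leaves at least \<open>3 * t\<close> midpoints,
  \<open>t\<close> of which share a depth class modulo 3. The size assumption is this count.\<close>

lemma exists_slots:
  assumes par: "\<forall>i\<in>{1..<n}. par i < i" and deg: "\<forall>i<n. card (children n par i) \<le> D"
    and size: "4 * D * t + 3 * t + 2 \<le> n" "t \<ge> 1"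
  obtains S where "S \<subseteq> {1..<n}" "card S = t" "inj_on par S" "0 \<notin> par ` S" "par ` S \<inter> S = {}"
    "(\<Union>s\<in>S. children n par s) \<inter> S = {}" "(\<Union>s\<in>S. children n par s) \<inter> par ` S = {}"
    "(\<forall>s\<in>S. children n par s = {}) \<or> (\<forall>s\<in>S. card (children n par s) = 1)"
proof -
  define Z where "Z = {i \<in> {..<n}. children n par i = {}}"
  have n2: "n \<ge> 2" using size by linarith
  have Z0: "0 \<notin> Z"
  proof -
    have "par 1 = 0" using par n2 by auto
    then have "1 \<in> children n par 0" using n2 by (auto simp: children_def)
    then show ?thesis by (auto simp: Z_def)
  qed
  have finZ: "finite Z" by (auto simp: Z_def)
  show ?thesis
  proof (cases "card (par ` Z) \<ge> t + 1")
    \<comment> \<open>One parent more than \<open>t\<close>, because the root is discarded from the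
      parents.\<close>
    case True
    then have "card (par ` Z - {0}) \<ge> t"
      using diff_card_le_card_Diff[of "{0}" "par ` Z"] by simp
    then obtain P where P: "P \<subseteq> par ` Z - {0}" "card P = t" by (meson obtain_subset_with_card_n)
    then obtain S where S: "S \<subseteq> Z" "inj_on par S" "P = par ` S"
      by (metis Diff_subset order_trans subset_image_inj)
    have "S \<subseteq> {1..<n}"
    proof
      fix s assume "s \<in> S"
      then have "s \<in> Z" using S by blast
      moreover from this have "s \<noteq> 0" using Z0 by metis
      ultimately show "s \<in> {1..<n}" by (auto simp: Z_def)
    qed
    moreover have "children n par s = {}" if "s \<in> S" for s using S that by (auto simp: Z_def)
    moreover have "par ` S \<inter> S = {}"
      using calculation by (force simp: children_def)
    moreover have "card S = t" using P S by (simp add: card_image)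
    moreover have "0 \<notin> par ` S" using P S by auto
    ultimately show ?thesis using S by (intro that[of S]) auto
  next
    case False
    have "Z \<subseteq> (\<Union>i\<in>par ` Z. children n par i)"
    proof
      fix z assume "z \<in> Z"
      then have "z \<in> {1..<n}" using Z0 by (cases z) (auto simp: Z_def)
      then show "z \<in> (\<Union>i\<in>par ` Z. children n par i)" using \<open>z \<in> Z\<close> by (auto simp: children_def)
    qed
    then have "card Z \<le> card (\<Union>i\<in>par ` Z. children n par i)" using finZ by (intro card_mono) auto
    also have "\<dots> \<le> D * card (par ` Z)"
    proof (rule card_children_UN_le[OF deg])
      show "par ` Z \<subseteq> {..<n}"
      proof
        fix x assume "x \<in> par ` Z"
        then obtain z where z: "z \<in> Z" "x = par z" by auto
        then have "z \<in> {1..<n}" using Z0 by (cases z) (auto simp: Z_def)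
        then have "par z < z" using par by blast
        then show "x \<in> {..<n}" using z \<open>z \<in> {1..<n}\<close> by auto
      qed
    qed
    also have "\<dots> \<le> D * t" using False by (intro mult_le_mono) auto
    finally have Zle: "card Z \<le> D * t" .
    define M where "M = {s \<in> {1..<n}. card (children n par s) = 1 \<and> card (children n par (par s)) = 1 \<and> par s \<noteq> 0}"
    have finM: "finite M" by (simp add: M_def)
    have "n \<le> card M + 4 * card Z + 2"
      unfolding M_def Z_def by (rule bare_path_midpoints[OF par n2])
    then have cM: "3 * t \<le> card M" using Zle size by linarith
    obtain dep :: "nat \<Rightarrow> nat" where dep: "\<forall>i\<in>{1..<n}. dep i = Suc (dep (par i))"
      using parent_array_depth[OF par] by blast
    \<comment> \<open>A slot that is the parent or child of another, or whose child is the parent of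
      another, differs from it in depth by 1 or 2; modulus 3 excludes both.\<close>
    have "\<exists>r<3. card {s \<in> M. dep s mod 3 = r} \<ge> t"
    proof (rule ccontr)
      assume "\<not> ?thesis"
      then have "\<forall>r<3. card {s \<in> M. dep s mod 3 = r} < t" by (meson not_le)
      then have lt: "card {s \<in> M. dep s mod 3 = 0} < t" "card {s \<in> M. dep s mod 3 = 1} < t"
        "card {s \<in> M. dep s mod 3 = 2} < t" by auto
      have "M = {s \<in> M. dep s mod 3 = 0} \<union> {s \<in> M. dep s mod 3 = 1} \<union> {s \<in> M. dep s mod 3 = 2}"
        by auto
      then have "card M \<le> card {s \<in> M. dep s mod 3 = 0} + card {s \<in> M. dep s mod 3 = 1} + card {s \<in> M. dep s mod 3 = 2}"
        by (metis (no_types, lifting) add_le_mono1 card_Un_le order_trans)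
      then show False using lt cM by linarith
    qed
    then obtain r where r: "card {s \<in> M. dep s mod 3 = r} \<ge> t" by blast
    then obtain S where S: "S \<subseteq> {s \<in> M. dep s mod 3 = r}" "card S = t"
      by (meson obtain_subset_with_card_n)
    have SM: "s \<in> {1..<n}" "card (children n par s) = 1" "card (children n par (par s)) = 1"
      "par s \<noteq> 0" "dep s mod 3 = r" "par s < s" "par s \<in> {1..<n}" "dep s = Suc (dep (par s))" if "s \<in> S" for s
    proof -
      show "s \<in> {1..<n}" "card (children n par s) = 1" "card (children n par (par s)) = 1"
        "par s \<noteq> 0" "dep s mod 3 = r" using S that by (auto simp: M_def)
      then show "par s < s" "dep s = Suc (dep (par s))" using par dep by auto
      then show "par s \<in> {1..<n}" using \<open>s \<in> {1..<n}\<close> \<open>par s \<noteq> 0\<close> by simp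
    qed
    have inj: "inj_on par S"
    proof (rule inj_onI)
      fix x y assume xy: "x \<in> S" "y \<in> S" "par x = par y"
      then have "x \<in> children n par (par x)" "y \<in> children n par (par x)"
        using SM(1) by (auto simp: children_def)
      then show "x = y" using SM(3)[OF xy(1)] by (metis card_1_singletonE singletonD)
    qed
    have ne: "x \<noteq> par y" if "x \<in> S" "y \<in> S" for x y
    proof
      assume "x = par y"
      then have "dep y = Suc (dep x)" using SM(8) that by simp
      moreover have "dep y mod 3 = dep x mod 3" using SM(5) that by simp
      ultimately show False by presburger
    qed
    have ch: "c \<notin> S" "c \<notin> par ` S" if c: "s \<in> S" "c \<in> children n par s" for c s
    proof -
      have ds: "dep c = Suc (dep s)" using dep c by (auto simp: children_def)
      show "c \<notin> S"
      proof
        assume "c \<in> S"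
        then have "dep c mod 3 = dep s mod 3" using SM(5) c by simp
        then show False using ds by presburger
      qed
      show "c \<notin> par ` S"
      proof
        assume "c \<in> par ` S"
        then obtain s' where s': "s' \<in> S" "c = par s'" by auto
        then have "dep s' = Suc (Suc (dep s))" using SM(8) ds by simp
        moreover have "dep s' mod 3 = dep s mod 3" using SM(5) s' c by simp
        ultimately show False by presburger
      qed
    qed
    show ?thesis
    proof (rule that)
      show "S \<subseteq> {1..<n}" using SM(1) by blast
      show "0 \<notin> par ` S" using SM(4) by (metis imageE)
      show "par ` S \<inter> S = {}" using ne by blast
      show "(\<Union>s\<in>S. children n par s) \<inter> S = {}" "(\<Union>s\<in>S. children n par s) \<inter> par ` S = {}"
        using ch by blast+
      show "(\<forall>s\<in>S. children n par s = {}) \<or> (\<forall>s\<in>S. card (children n par s) = 1)"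
        using SM(2) by blast
    qed (use S inj in auto)
  qed
qed

section \<open>Embedding all but the slots\<close>

text \<open>No two slots are adjacent or share a neighbour. So a slot is constrained only by the
  images of its own parent in \<open>P\<close> and of its child in \<open>C\<close>, if it has one,
  and all slots can be filled at once by a matching. By \<open>children_cases\<close> the set
  \<open>C\<close> is empty or has size \<open>t\<close>.\<close>

locale slotted_tree =
  fixes n D t :: nat and par :: "nat \<Rightarrow> nat" and S :: "nat set"
  assumes par_less: "i \<in> {1..<n} \<Longrightarrow> par i < i"
    and card_children: "i < n \<Longrightarrow> card (children n par i) \<le> D"
    and S_subset: "S \<subseteq> {1..<n}" and card_S: "card S = t"
    and inj_par: "inj_on par S" and root_notin: "0 \<notin> par ` S" and parents_S: "par ` S \<inter> S = {}"
    and children_S: "(\<Union>s\<in>S. children n par s) \<inter> S = {}"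
    and children_parents: "(\<Union>s\<in>S. children n par s) \<inter> par ` S = {}"
    and children_cases: "(\<forall>s\<in>S. children n par s = {}) \<or> (\<forall>s\<in>S. card (children n par s) = 1)"
begin

definition P :: "nat set" where "P = par ` S"
definition C :: "nat set" where "C = (\<Union>s\<in>S. children n par s)"

lemma finite_S: "finite S" using S_subset finite_subset by blast

lemma C_iff: "c \<in> C \<longleftrightarrow> c \<in> {1..<n} \<and> par c \<in> S"
  by (auto simp: C_def children_def)

lemma PCS_disjoint: "P \<inter> S = {}" "C \<inter> S = {}" "C \<inter> P = {}" "0 \<notin> P" "0 \<notin> S" "0 \<notin> C"
  using parents_S children_S children_parents root_notin S_subset by (auto simp: P_def C_def children_def)

lemma PCS_subset: "P \<subseteq> {..<n}" "C \<subseteq> {..<n}" "S \<subseteq> {..<n}"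
proof -
  show "S \<subseteq> {..<n}" using S_subset by auto
  show "C \<subseteq> {..<n}" using C_iff by auto
  show "P \<subseteq> {..<n}"
  proof
    fix x assume "x \<in> P"
    then obtain s where "s \<in> S" "x = par s" by (auto simp: P_def)
    moreover from this have "s \<in> {1..<n}" using S_subset by blast
    ultimately show "x \<in> {..<n}" using par_less[of s] by auto
  qed
qed

lemma finite_PC: "finite P" "finite C"
  using PCS_subset finite_subset by blast+

lemma card_P: "card P = t"
  using inj_par card_S by (simp add: P_def card_image)

lemma inj_par_C: "inj_on par C"
proof (rule inj_onI)
  fix x y assume xy: "x \<in> C" "y \<in> C" "par x = par y"
  then have s: "par x \<in> S" "x \<in> children n par (par x)" "y \<in> children n par (par x)"
    by (auto simp: C_iff children_def)
  then have "card (children n par (par x)) = 1" using children_cases by fastforce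
  then show "x = y" using s by (metis card_1_singletonE singletonD)
qed

text \<open>This keeps the rule "go to the \<open>\<beta>\<close>-partner of the grandparent's
  image" free of collisions.\<close>

lemma inj_par_par_C: "inj_on (\<lambda>c. par (par c)) C"
proof -
  have "inj_on (par \<circ> par) C"
    using inj_par_C inj_par C_iff by (intro comp_inj_on) (auto intro: inj_on_subset)
  then show ?thesis by (simp add: comp_def)
qed

lemma par_par_C:
  assumes "c \<in> C"
  shows "par (par c) \<in> P" "par (par c) < c" "par c < c"
proof -
  have "c \<in> {1..<n}" "par c \<in> S" using assms by (auto simp: C_iff)
  then show "par (par c) \<in> P" "par c < c" using par_less by (auto simp: P_def)
  moreover have "par (par c) < par c" using par_less[of "par c"] \<open>par c \<in> S\<close> S_subset by blast
  ultimately show "par (par c) < c" by linarith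
qed

end

text \<open>\<open>A\<close> is meant for \<open>P\<close>, its image under \<open>\<beta>\<close>
  for \<open>C\<close>, and \<open>V1\<close> for all other vertices. The two cardinality
  assumptions keep \<open>m\<close> vertices free after all that is aimed at a set has been placed:
  \<open>t\<close> parents in \<open>A\<close>; in \<open>V1\<close> the
  \<open>n - 2 * t - card C\<close> ordinary vertices and at most \<open>D * m\<close> children of
  slots that get no partner. For empty \<open>C\<close> the partners may overlap
  \<open>V1\<close>.\<close>

locale tree_embedding = slotted_tree n D t par S
  for n D t :: nat and par and S +
  fixes E :: "'v set set" and A R V1 :: "'v set" and \<beta> :: "'v \<Rightarrow> 'v" and m :: nat
  assumes m_pos: "0 < m" and fin: "finite A" "finite R" "finite V1"
    and disj: "A \<inter> R = {}" "A \<inter> V1 = {}" "R \<inter> V1 = {}"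
    and inj_\<beta>: "inj_on \<beta> A" and partner_disj: "C \<noteq> {} \<Longrightarrow> \<beta> ` A \<inter> (A \<union> R \<union> V1) = {}"
    and expand: "\<And>X Y. X \<subseteq> A \<union> \<beta> ` A \<union> R \<union> V1 \<Longrightarrow> Y \<subseteq> A \<union> V1 \<Longrightarrow> m \<le> card X \<Longrightarrow> m \<le> card Y
        \<Longrightarrow> \<exists>x\<in>X. \<exists>y\<in>Y. {x, y} \<in> E"
    and reserve: "\<And>x. x \<in> A \<union> \<beta> ` A \<union> R \<union> V1 \<Longrightarrow> 2 * D * m < card {w \<in> R. {x, w} \<in> E}"
    and card_A: "t + m \<le> card A" and card_V1: "n + D * m + m \<le> card V1 + 2 * t + card C"
begin

definition V :: "'v set" where "V = A \<union> \<beta> ` A \<union> R \<union> V1"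

definition used :: "(nat \<Rightarrow> 'v) \<Rightarrow> nat \<Rightarrow> 'v set" where
  "used f j = f ` ({..<j} - S)"

definition bad :: "(nat \<Rightarrow> 'v) \<Rightarrow> nat \<Rightarrow> 'v set \<Rightarrow> 'v set" where
  "bad f j Y = {x \<in> V. \<forall>y\<in>Y - used f j. {x, y} \<notin> E}"

definition tgt :: "nat \<Rightarrow> 'v set" where
  "tgt v = (if v \<in> P then A else V1)"

text \<open>As the set of free vertices shrinks, the set of bad vertices only grows, and it never
  reaches size \<^term>\<open>m\<close>. So the fallback to \<^term>\<open>R\<close>, recorded in \<open>placed\<close>, is rare.\<close>

definition partial_embedding :: "(nat \<Rightarrow> 'v) \<Rightarrow> nat \<Rightarrow> bool" where
  "partial_embedding f j \<longleftrightarrow> inj_on f ({..<j} - S) \<and> used f j \<subseteq> V \<and>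
     (\<forall>v\<in>{1..<j} - S. par v \<notin> S \<longrightarrow> {f (par v), f v} \<in> E) \<and>
     (\<forall>v\<in>{..<j} - S - C. f v \<in> tgt v \<or> f v \<in> R \<and> 1 \<le> v \<and> f (par v) \<in> bad f j (tgt v)) \<and>
     (\<forall>c\<in>C. c < j \<longrightarrow> (if f (par (par c)) \<in> A then f c = \<beta> (f (par (par c))) else f c \<in> V1))"

lemma partial_embeddingD:
  assumes "partial_embedding f j"
  shows inj: "inj_on f ({..<j} - S)" and used_V: "used f j \<subseteq> V"
    and edge: "\<And>v. v \<in> {1..<j} - S \<Longrightarrow> par v \<notin> S \<Longrightarrow> {f (par v), f v} \<in> E"
    and placed: "\<And>v. v < j \<Longrightarrow> v \<notin> S \<Longrightarrow> v \<notin> C \<Longrightarrow>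
      f v \<in> tgt v \<or> f v \<in> R \<and> 1 \<le> v \<and> f (par v) \<in> bad f j (tgt v)"
    and partner: "\<And>c. c \<in> C \<Longrightarrow> c < j \<Longrightarrow> f (par (par c)) \<in> A \<Longrightarrow> f c = \<beta> (f (par (par c)))"
    and partnerless: "\<And>c. c \<in> C \<Longrightarrow> c < j \<Longrightarrow> f (par (par c)) \<notin> A \<Longrightarrow> f c \<in> V1"
  using assms unfolding partial_embedding_def by auto

section \<open>Counting free vertices and exceptions\<close>

lemma finite_V: "finite V" using fin by (simp add: V_def)

lemma finite_used [simp]: "finite (used f j)" by (simp add: used_def)

lemma used_Suc: "used f j \<subseteq> used (f(j := y)) (Suc j)"
  by (force simp: used_def)

lemma C_image:
  assumes "partial_embedding f j" "c \<in> C" "c < j"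
  shows "f c \<in> V1 \<or> f c \<in> \<beta> ` A"
  using partner[OF assms] partnerless[OF assms] by blast

lemma C_image_notin:
  assumes "partial_embedding f j" "c \<in> C" "c < j"
  shows "f c \<notin> A" "f c \<notin> R"
  using C_image[OF assms] partner_disj disj assms(2) by blast+

lemma placed_A:
  assumes "partial_embedding f j" "v < j" "v \<notin> S" "f v \<in> A"
  shows "v \<in> P"
proof (rule ccontr)
  assume "v \<notin> P"
  moreover have "v \<notin> C" using C_image_notin[OF assms(1)] assms by blast
  ultimately show False using placed[OF assms(1-3)] assms(4) disj by (auto simp: tgt_def)
qed

text \<open>By \<open>placed_A\<close> only the \<open>t\<close> parents of slots can have landed in
  \<open>A\<close>.\<close>

lemma free_A:
  assumes "partial_embedding f j"
  shows "m \<le> card (A - used f j)"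
proof -
  have "A \<inter> used f j \<subseteq> f ` P" using placed_A[OF assms] by (auto simp: used_def)
  then have "card (A \<inter> used f j) \<le> card (f ` P)" using finite_PC by (intro card_mono) auto
  also have "\<dots> \<le> t" using card_image_le[OF finite_PC(1), of f] card_P by simp
  finally have "card A - t \<le> card (A - A \<inter> used f j)"
    using diff_card_le_card_Diff[of "A \<inter> used f j" A] by simp
  then show ?thesis using card_A by (simp add: Diff_Int)
qed

text \<open>Otherwise \<open>expand\<close>, applied to the bad vertices and the free part of
  \<open>Y\<close>, would produce a forbidden edge.\<close>

lemma card_bad:
  assumes "m \<le> card (Y - used f j)" "Y \<subseteq> A \<union> V1"
  shows "card (bad f j Y) \<le> m"
proof (rule ccontr)
  assume "\<not> ?thesis"
  then have "\<exists>x\<in>bad f j Y. \<exists>y\<in>Y - used f j. {x, y} \<in> E"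
    using assms by (intro expand) (auto simp: bad_def V_def)
  then show False by (auto simp: bad_def)
qed

lemma card_children_preimage:
  assumes "inj_on f ({..<j} - S)" "j \<le> n" "finite X" "card X \<le> k"
  shows "card (\<Union>u\<in>{u \<in> {..<j} - S. f u \<in> X}. children n par u) \<le> D * k"
proof -
  have "card {u \<in> {..<j} - S. f u \<in> X} \<le> card X"
    using assms by (intro card_inj_on_le[of f]) (auto intro: inj_on_subset)
  then have "D * card {u \<in> {..<j} - S. f u \<in> X} \<le> D * k" using assms by simp
  moreover have "card (\<Union>u\<in>{u \<in> {..<j} - S. f u \<in> X}. children n par u) \<le> D * card {u \<in> {..<j} - S. f u \<in> X}"
    using card_children assms(2) by (intro card_children_UN_le) auto
  ultimately show ?thesis by linarith
qed

lemma parent_placed: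
  assumes "v < j" "1 \<le> v" "j \<le> n" "v \<notin> C"
  shows "par v \<in> {..<j} - S" "v \<in> children n par (par v)"
proof -
  have v: "v \<in> {1..<n}" using assms by auto
  then have "par v < v" by (rule par_less)
  then show "par v \<in> {..<j} - S" "v \<in> children n par (par v)"
    using v assms C_iff by (auto simp: children_def)
qed

text \<open>A parent of a slot that missed \<open>A\<close> is a child of a vertex whose image is
  bad for \<open>A\<close>. Since badness persists, it is enough to count the images that are bad
  now: at most \<open>m\<close>, with at most \<open>D\<close> children each.\<close>

lemma card_exceptional:
  assumes f: "partial_embedding f j" and j: "j \<le> n"
  shows "card {v \<in> P. v < j \<and> f v \<notin> A} \<le> D * m"
proof -
  have "{v \<in> P. v < j \<and> f v \<notin> A} \<subseteq> (\<Union>u\<in>{u \<in> {..<j} - S. f u \<in> bad f j A}. children n par u)"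
  proof
    fix v assume v: "v \<in> {v \<in> P. v < j \<and> f v \<notin> A}"
    then have vSC: "v \<notin> S" "v \<notin> C" using PCS_disjoint by blast+
    then have "1 \<le> v" "f (par v) \<in> bad f j A" using placed[OF f, of v] v by (auto simp: tgt_def)
    then show "v \<in> (\<Union>u\<in>{u \<in> {..<j} - S. f u \<in> bad f j A}. children n par u)"
      using parent_placed[of v j] v j vSC by blast
  qed
  then have "card {v \<in> P. v < j \<and> f v \<notin> A}
      \<le> card (\<Union>u\<in>{u \<in> {..<j} - S. f u \<in> bad f j A}. children n par u)"
    by (intro card_mono) auto
  also have "\<dots> \<le> D * m"
    using finite_V by (intro card_children_preimage[OF inj[OF f] j] card_bad free_A[OF f]) (auto simp: bad_def)
  finally show ?thesis .
qed

text \<open>\<open>V1\<close> receives only vertices outside \<open>S\<close>, \<open>P\<close>,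
  \<open>C\<close> and children of slots without partner. The latter inject, via their grandparents,
  into the exceptional parents.\<close>

lemma free_V1:
  assumes f: "partial_embedding f j" and j: "j \<le> n"
  shows "m \<le> card (V1 - used f j)"
proof -
  let ?C = "{c \<in> C. c < j \<and> f (par (par c)) \<notin> A}"
  have "V1 \<inter> used f j \<subseteq> f ` (({..<n} - (S \<union> P \<union> C)) \<union> ?C)"
  proof
    fix y assume y: "y \<in> V1 \<inter> used f j"
    then obtain v where v: "v < j" "v \<notin> S" "y = f v" by (auto simp: used_def)
    have "v \<notin> P"
    proof
      assume vP: "v \<in> P"
      then have "v \<notin> C" using PCS_disjoint by blast
      then show False using placed[OF f v(1,2)] vP y v disj by (auto simp: tgt_def)
    qed
    moreover have "f (par (par v)) \<notin> A" if vC: "v \<in> C"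
    proof
      assume a: "f (par (par v)) \<in> A"
      then have "f v \<in> \<beta> ` A" using partner[OF f vC v(1)] by blast
      then show False using y v partner_disj vC by blast
    qed
    ultimately show "y \<in> f ` (({..<n} - (S \<union> P \<union> C)) \<union> ?C)" using v j by auto
  qed
  then have "card (V1 \<inter> used f j) \<le> card (f ` (({..<n} - (S \<union> P \<union> C)) \<union> ?C))"
    using finite_PC by (intro card_mono) auto
  also have "\<dots> \<le> card (({..<n} - (S \<union> P \<union> C)) \<union> ?C)"
    using finite_PC by (intro card_image_le) auto
  also have "\<dots> \<le> card ({..<n} - (S \<union> P \<union> C)) + card ?C" by (rule card_Un_le)
  also have "card ({..<n} - (S \<union> P \<union> C)) = n - (2 * t + card C)"
  proof -
    have "card (S \<union> P \<union> C) = 2 * t + card C"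
      using PCS_disjoint finite_PC finite_S card_S card_P
      by (subst card_Un_disjoint; (subst card_Un_disjoint)?) auto
    then show ?thesis using PCS_subset finite_PC finite_S by (subst card_Diff_subset) auto
  qed
  also have "card ?C \<le> card {v \<in> P. v < j \<and> f v \<notin> A}"
    using finite_PC par_par_C inj_par_par_C
    by (intro card_inj_on_le[of "\<lambda>c. par (par c)"]) (force intro: inj_on_subset)+
  also have "\<dots> \<le> D * m" by (rule card_exceptional[OF assms])
  finally have "card (V1 \<inter> used f j) \<le> n - (2 * t + card C) + D * m" by simp
  moreover have "2 * t + card C \<le> n"
  proof -
    have "card (S \<union> P \<union> C) = 2 * t + card C"
      using PCS_disjoint finite_PC finite_S card_S card_P
      by (subst card_Un_disjoint; (subst card_Un_disjoint)?) auto
    moreover have "card (S \<union> P \<union> C) \<le> card {..<n}" using PCS_subset by (intro card_mono) auto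
    ultimately show ?thesis by simp
  qed
  moreover have "card V1 - card (V1 \<inter> used f j) \<le> card (V1 - V1 \<inter> used f j)"
    using diff_card_le_card_Diff[of "V1 \<inter> used f j" V1] by simp
  ultimately show ?thesis using card_V1 by (simp add: Diff_Int)
qed

text \<open>A vertex falls back to \<open>R\<close> only below an image that is bad for
  \<open>A\<close> or for \<open>V1\<close>; the two targets account for the factor 2.\<close>

lemma card_used_R:
  assumes f: "partial_embedding f j" and j: "j \<le> n"
  shows "card (R \<inter> used f j) \<le> 2 * D * m"
proof -
  let ?B = "bad f j A \<union> bad f j V1"
  have "{v \<in> {..<j} - S. f v \<in> R} \<subseteq> (\<Union>u\<in>{u \<in> {..<j} - S. f u \<in> ?B}. children n par u)"
  proof
    fix v assume v: "v \<in> {v \<in> {..<j} - S. f v \<in> R}"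
    then have vC: "v \<notin> C" using C_image_notin[OF f] by blast
    have "tgt v = A \<or> tgt v = V1" by (simp add: tgt_def)
    then have "1 \<le> v" "f (par v) \<in> ?B"
      using placed[OF f, of v] v vC disj by auto
    then show "v \<in> (\<Union>u\<in>{u \<in> {..<j} - S. f u \<in> ?B}. children n par u)"
      using parent_placed[of v j] v j vC by blast
  qed
  then have "card {v \<in> {..<j} - S. f v \<in> R} \<le> card (\<Union>u\<in>{u \<in> {..<j} - S. f u \<in> ?B}. children n par u)"
    by (intro card_mono) auto
  also have "\<dots> \<le> D * (m + m)"
  proof (rule card_children_preimage[OF inj[OF f] j])
    show "finite ?B" using finite_V by (auto simp: bad_def)
    have "card (bad f j A) \<le> m" "card (bad f j V1) \<le> m"
      using card_bad free_A[OF f] free_V1[OF f j] by auto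
    then show "card ?B \<le> m + m" by (meson add_mono card_Un_le order_trans)
  qed
  also have "D * (m + m) = 2 * D * m" by simp
  finally have 1: "card {v \<in> {..<j} - S. f v \<in> R} \<le> 2 * D * m" .
  have "R \<inter> used f j \<subseteq> f ` {v \<in> {..<j} - S. f v \<in> R}" by (auto simp: used_def)
  then have "card (R \<inter> used f j) \<le> card (f ` {v \<in> {..<j} - S. f v \<in> R})" by (intro card_mono) auto
  also have "\<dots> \<le> card {v \<in> {..<j} - S. f v \<in> R}" by (intro card_image_le) auto
  finally show "card (R \<inter> used f j) \<le> 2 * D * m" using 1 by simp
qed

section \<open>One step of the greedy embedding\<close>

lemma extend:
  assumes f: "partial_embedding f j" and j: "j < n" "j \<notin> S" and y: "y \<in> V" "y \<notin> used f j"
    and e: "1 \<le> j \<Longrightarrow> par j \<notin> S \<Longrightarrow> {f (par j), y} \<in> E"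
    and p: "j \<notin> C \<Longrightarrow> y \<in> tgt j \<or> y \<in> R \<and> 1 \<le> j \<and> f (par j) \<in> bad f j (tgt j)"
    and c: "j \<in> C \<Longrightarrow> if f (par (par j)) \<in> A then y = \<beta> (f (par (par j))) else y \<in> V1"
  shows "partial_embedding (f(j := y)) (Suc j)"
proof -
  let ?f = "f(j := y)"
  have same: "?f v = f v" if "v < j" for v using that by simp
  have dom: "{..<Suc j} - S = insert j ({..<j} - S)" using j by auto
  have parlt: "par v < j" if "1 \<le> v" "v \<le> j" for v using par_less[of v] that j by simp
  have "inj_on ?f ({..<Suc j} - S)"
    unfolding dom using inj[OF f] y(2) by (auto simp: inj_on_def used_def)
  moreover have "used ?f (Suc j) \<subseteq> V" 
    using used_V[OF f] y(1) unfolding used_def dom by auto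
  moreover have "{?f (par v), ?f v} \<in> E" if "v \<in> {1..<Suc j} - S" "par v \<notin> S" for v
    using edge[OF f, of v] e that parlt[of v] by (cases "v = j") auto
  moreover have "?f v \<in> tgt v \<or> ?f v \<in> R \<and> 1 \<le> v \<and> ?f (par v) \<in> bad ?f (Suc j) (tgt v)"
    if v: "v \<in> {..<Suc j} - S - C" for v
  proof -
    \<comment> \<open>Badness is monotone, so earlier recourse to the reserve stays
      justified.\<close>
    have "bad f j (tgt v) \<subseteq> bad ?f (Suc j) (tgt v)" using used_Suc[of f j y] by (auto simp: bad_def)
    then show ?thesis using placed[OF f, of v] p v parlt[of v] by (cases "v = j") auto
  qed
  moreover have "if ?f (par (par c)) \<in> A then ?f c = \<beta> (?f (par (par c))) else ?f c \<in> V1"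
    if "c \<in> C" "c < Suc j" for c
    using partner[OF f, of c] partnerless[OF f, of c] c that par_par_C[of c]
    by (cases "c = j") auto
  ultimately show ?thesis unfolding partial_embedding_def by blast
qed

text \<open>Partners outside the other regions are occupied only by children of slots, and different
  children have different grandparents, hence different partners.\<close>

lemma partner_free:
  assumes f: "partial_embedding f j" and j: "j \<in> C" and a: "f (par (par j)) \<in> A"
  shows "\<beta> (f (par (par j))) \<notin> used f j"
proof
  assume "\<beta> (f (par (par j))) \<in> used f j"
  then obtain u where u: "u < j" "u \<notin> S" "f u = \<beta> (f (par (par j)))" by (auto simp: used_def)
  have "C \<noteq> {}" using j by blast
  then have notin: "f u \<notin> A" "f u \<notin> R" "f u \<notin> V1" using u a partner_disj by auto
  have uC: "u \<in> C"
  proof (rule ccontr)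
    assume "u \<notin> C"
    then show False using placed[OF f u(1,2)] notin by (cases "u \<in> P") (auto simp: tgt_def)
  qed
  then have "f (par (par u)) \<in> A" using partnerless[OF f uC u(1)] notin by blast
  moreover have "\<beta> (f (par (par u))) = \<beta> (f (par (par j)))"
    using partner[OF f uC u(1)] calculation u by simp
  ultimately have "f (par (par u)) = f (par (par j))" using inj_\<beta> a by (meson inj_onD)
  moreover have "par (par u) \<in> {..<j} - S" "par (par j) \<in> {..<j} - S"
    using par_par_C[OF uC] par_par_C[OF j] u PCS_disjoint by fastforce+
  ultimately have "par (par u) = par (par j)" using inj[OF f] by (meson inj_onD)
  then have "u = j" by (rule inj_onD[OF inj_par_par_C _ uC j])
  then show False using u(1) by simp
qed

lemma step:
  assumes f: "partial_embedding f j" and j: "j < n"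
  shows "\<exists>f. partial_embedding f (Suc j)"
proof (cases "j \<in> S")
  case True
  then have eq: "{..<Suc j} - S = {..<j} - S" by (auto simp: less_Suc_eq)
  have "used f (Suc j) = used f j" by (simp add: used_def eq)
  then have "bad f (Suc j) = bad f j" by (auto simp: bad_def fun_eq_iff)
  moreover have "j \<notin> C" using True PCS_disjoint by blast
  ultimately have "partial_embedding f (Suc j)"
    using f True eq \<open>used f (Suc j) = used f j\<close> unfolding partial_embedding_def
    by (auto simp: less_Suc_eq)
  then show ?thesis by blast
next
  case jS: False
  have "V1 - used f j \<noteq> {}"
    using free_V1[OF f] j m_pos by (metis card.empty less_imp_le not_le)
  \<comment> \<open>The default image for the root and for children of slots whose grandparent
    missed \<open>A\<close>.\<close>
  then obtain z where z: "z \<in> V1" "z \<notin> used f j" by blast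
  then have zV: "z \<in> V" by (simp add: V_def)
  show ?thesis
  proof (cases "j \<in> C")
    case True
    \<comment> \<open>The parent of \<open>j\<close> is a slot and has no image, so no edge
      restricts the choice for \<open>j\<close>.\<close>
    then have "par j \<in> S" by (simp add: C_iff)
    show ?thesis
    proof (cases "f (par (par j)) \<in> A")
      case a: True
      then show ?thesis using True \<open>par j \<in> S\<close> partner_free[OF f True a]
        by - (rule exI, rule extend[OF f j jS, of "\<beta> (f (par (par j)))"], auto simp: V_def)
    next
      case False
      then show ?thesis using True \<open>par j \<in> S\<close> z zV
        by - (rule exI, rule extend[OF f j jS, of z], auto)
    qed
  next
    case jC: False
    show ?thesis
    proof (cases "j = 0")
      case True
      then show ?thesis using jC z zV PCS_disjoint
        by - (rule exI, rule extend[OF f j jS, of z], auto simp: tgt_def)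
    next
      case False
      then have jn: "1 \<le> j" "j \<in> {1..<n}" using j by auto
      then have parj: "par j < j" "par j \<notin> S" using par_less jC C_iff by auto
      let ?x = "f (par j)"
      have x: "?x \<in> V" using used_V[OF f] parj by (auto simp: used_def)
      have "\<exists>y. (y \<in> tgt j \<or> y \<in> R \<and> 1 \<le> j \<and> ?x \<in> bad f j (tgt j)) \<and> y \<in> V \<and> y \<notin> used f j \<and> {?x, y} \<in> E"
      proof (cases "?x \<in> bad f j (tgt j)")
        case False
        then obtain y where "y \<in> tgt j" "y \<notin> used f j" "{?x, y} \<in> E" using x by (auto simp: bad_def)
        moreover have "tgt j \<subseteq> V" by (auto simp: tgt_def V_def)
        ultimately show ?thesis by blast
      next
        case True
        have "card (R \<inter> used f j) < card {w \<in> R. {?x, w} \<in> E}"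
          using card_used_R[OF f] j reserve[of ?x] x unfolding V_def
          by (meson le_less_trans less_imp_le)
        then have "\<not> {w \<in> R. {?x, w} \<in> E} \<subseteq> R \<inter> used f j"
          by (metis card_mono finite_Int finite_used leD)
        then obtain y where "y \<in> R" "y \<notin> used f j" "{?x, y} \<in> E" by blast
        then show ?thesis using True jn by (auto simp: V_def)
      qed
      then obtain y where "y \<in> tgt j \<or> y \<in> R \<and> 1 \<le> j \<and> ?x \<in> bad f j (tgt j)" "y \<in> V"
        "y \<notin> used f j" "{?x, y} \<in> E" by blast
      then show ?thesis using jC by - (rule exI, rule extend[OF f j jS, of y], auto)
    qed
  qed
qed

lemma ex_embedding:
  obtains f where "inj_on f ({..<n} - S)" "f ` ({..<n} - S) \<subseteq> A \<union> \<beta> ` A \<union> R \<union> V1"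
    "\<And>v. v \<in> {1..<n} - S \<Longrightarrow> par v \<notin> S \<Longrightarrow> {f (par v), f v} \<in> E"
    "card (R \<inter> f ` ({..<n} - S)) \<le> 2 * D * m"
    "card {s \<in> S. f (par s) \<notin> A} \<le> D * m"
    "\<And>c. c \<in> C \<Longrightarrow> f (par (par c)) \<in> A \<Longrightarrow> f c = \<beta> (f (par (par c)))"
proof -
  have "\<exists>f. partial_embedding f j" if "j \<le> n" for j
    using that
  proof (induction j)
    case 0
    show ?case by (auto simp: partial_embedding_def used_def)
  next
    case (Suc j)
    then show ?case using step by (meson Suc_le_lessD less_imp_le)
  qed
  then obtain f where f: "partial_embedding f n" by blast
  have "card {s \<in> S. f (par s) \<notin> A} \<le> card {v \<in> P. v < n \<and> f v \<notin> A}"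
    using inj_par PCS_subset finite_PC
    by (intro card_inj_on_le[of par]) (auto simp: P_def intro: inj_on_subset)
  also have "\<dots> \<le> D * m" by (rule card_exceptional[OF f order_refl])
  finally have "card {s \<in> S. f (par s) \<notin> A} \<le> D * m" .
  then show ?thesis
    using inj[OF f] used_V[OF f] edge[OF f] card_used_R[OF f order_refl] partner[OF f] PCS_subset
    by (intro that[of f]) (auto simp: used_def V_def)
qed

end

section \<open>Filling the slots\<close>

text \<open>A pair \<open>(v, v)\<close> stands for the single vertex \<open>v\<close>; covering it means being adjacent to \<open>v\<close>.\<close>

definition covers :: "'v set set \<Rightarrow> 'v \<Rightarrow> 'v \<times> 'v \<Rightarrow> bool" where
  "covers E w x \<longleftrightarrow> {w, fst x} \<in> E \<and> {w, snd x} \<in> E"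

definition ends :: "'v \<times> 'v \<Rightarrow> 'v set" where
  "ends x = {fst x, snd x}"

definition disjoint_pairs :: "('v \<times> 'v) set \<Rightarrow> bool" where
  "disjoint_pairs X \<longleftrightarrow> pairwise (\<lambda>x y. ends x \<inter> ends y = {}) X"

text \<open>All that is needed from the graph, with no randomness left. The covering properties
  serve Hall's condition for few remaining vertices, for few slots, and for many of both. The excess
  \<open>2 * D * m\<close> pays for the reserve vertices consumed by the greedy embedding, or else
  for its \<open>D * m\<close> exceptional slots and the \<open>m\<close> spare vertices of
  \<open>A\<close>. The term \<open>3 * m\<close> in \<open>sizes\<close> is what
  \<open>card_V1\<close> demands when slots are midpoints and \<open>V1\<close> loses both
  \<open>A\<close> and its partners.\<close>

locale pair_expander =
  fixes n D m m' t :: nat and E :: "nat set set" and A R :: "nat set" and \<beta> :: "nat \<Rightarrow> nat"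
  assumes pos: "0 < m" "0 < m'" "1 \<le> D"
    and parts: "A \<subseteq> {..<n}" "\<beta> ` A \<subseteq> {..<n}" "R \<subseteq> {..<n}" "A \<inter> R = {}" "\<beta> ` A \<inter> (A \<union> R) = {}" "inj_on \<beta> A"
    and card_designated: "card A = t + m" and sizes: "card R + D * m + 3 * m \<le> t"
    and edge_expand: "\<And>X Y. X \<subseteq> {..<n} \<Longrightarrow> Y \<subseteq> {..<n} \<Longrightarrow> m \<le> card X \<Longrightarrow> m \<le> card Y
      \<Longrightarrow> \<exists>x\<in>X. \<exists>y\<in>Y. {x, y} \<in> E"
    and cover_designated: "\<And>Y. Y \<subseteq> {..<n} \<Longrightarrow> 1 \<le> card Y \<Longrightarrow> card Y \<le> m'
      \<Longrightarrow> card Y + 2 * D * m \<le> card {a \<in> A. \<exists>w\<in>Y. covers E w (a, \<beta> a)}"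
    and cover_reserve: "\<And>X. X \<subseteq> {..<n} \<times> {..<n} \<Longrightarrow> disjoint_pairs X \<Longrightarrow> 1 \<le> card X \<Longrightarrow> card X \<le> m'
      \<Longrightarrow> card X + 2 * D * m \<le> card {w \<in> R. \<exists>x\<in>X. covers E w x}"
    and cover_large: "\<And>X Y. X \<subseteq> {..<n} \<times> {..<n} \<Longrightarrow> Y \<subseteq> {..<n} \<Longrightarrow> disjoint_pairs X \<Longrightarrow> m' \<le> card X
      \<Longrightarrow> m' \<le> card Y \<Longrightarrow> Y \<inter> \<Union> (ends ` X) = {} \<Longrightarrow> \<exists>x\<in>X. \<exists>w\<in>Y. covers E w x"
begin

text \<open>A vertex is the degenerate pair \<open>(x, x)\<close>, so its degree into
  \<open>R\<close> is an instance of \<open>cover_reserve\<close>.\<close>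

lemma reserve_degree:
  assumes "x < n"
  shows "2 * D * m < card {w \<in> R. {x, w} \<in> E}"
proof -
  have "card {(x, x)} + 2 * D * m \<le> card {w \<in> R. \<exists>y\<in>{(x, x)}. covers E w y}"
    using assms pos by (intro cover_reserve) (auto simp: disjoint_pairs_def)
  then show ?thesis by (simp add: covers_def insert_commute)
qed

lemma spanning_embedding:
  assumes T: "slotted_tree n D t par S"
  obtains F where "inj_on F {..<n}" "F ` {..<n} \<subseteq> {..<n}" "\<And>v. v \<in> {1..<n} \<Longrightarrow> {F (par v), F v} \<in> E"
proof -
  interpret slotted_tree n D t par S by fact
  have finite: "finite A" "finite R" using parts finite_subset by blast+
  have card_\<beta>A: "card (\<beta> ` A) = t + m" using parts(6) card_designated by (simp add: card_image)
  \<comment> \<open>For leaf slots nothing is placed by partnership, so the partners return to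
    \<open>V1\<close>, which would be too small without them.\<close>
  define V1 where "V1 = {..<n} - (A \<union> R \<union> (if C = {} then {} else \<beta> ` A))"
  have V1: "n + D * m + m \<le> card V1 + 2 * t + card C"
  proof (cases "C = {}")
    case True
    have "card (A \<union> R) = t + m + card R"
      using finite parts card_designated by (subst card_Un_disjoint) auto
    then have "card V1 = n - (t + m + card R)"
      using True finite parts by (simp add: V1_def card_Diff_subset)
    then show ?thesis using True sizes by simp
  next
    case False
    have "card (A \<union> R \<union> \<beta> ` A) = t + m + card R + (t + m)"
      using finite parts card_designated card_\<beta>A by (subst card_Un_disjoint; (subst card_Un_disjoint)?) auto
    then have "card V1 = n - (t + m + card R + (t + m))"
      using False finite parts by (simp add: V1_def card_Diff_subset)
    moreover have "card C = t"
    proof -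
      have "\<forall>s\<in>S. card (children n par s) = 1" using children_cases False by (auto simp: C_def)
      moreover have "card C = (\<Sum>s\<in>S. card (children n par s))"
        unfolding C_def using finite_S by (intro card_UN_disjoint) (auto simp: children_def)
      ultimately show ?thesis using card_S by simp
    qed
    ultimately show ?thesis using sizes by simp
  qed
  have V: "A \<union> \<beta> ` A \<union> R \<union> V1 \<subseteq> {..<n}" using parts by (auto simp: V1_def)
  interpret tree_embedding n D t par S E A R V1 \<beta> m
  proof
    show "\<exists>x\<in>X. \<exists>y\<in>Y. {x, y} \<in> E"
      if "X \<subseteq> A \<union> \<beta> ` A \<union> R \<union> V1" "Y \<subseteq> A \<union> V1" "m \<le> card X" "m \<le> card Y" for X Y
    proof (intro edge_expand)
      show "X \<subseteq> {..<n}" "Y \<subseteq> {..<n}" using that V by blast+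
    qed (use that in auto)
    show "2 * D * m < card {w \<in> R. {x, w} \<in> E}" if "x \<in> A \<union> \<beta> ` A \<union> R \<union> V1" for x
      using that V by (intro reserve_degree) auto
    show "n + D * m + m \<le> card V1 + 2 * t + card C" by (rule V1)
    show "\<beta> ` A \<inter> (A \<union> R \<union> V1) = {}" if "C \<noteq> {}" using that parts by (auto simp: V1_def)
  qed (use pos parts finite card_designated in \<open>auto simp: V1_def\<close>)
  obtain f where f: "inj_on f ({..<n} - S)" "f ` ({..<n} - S) \<subseteq> A \<union> \<beta> ` A \<union> R \<union> V1"
    "\<And>v. v \<in> {1..<n} - S \<Longrightarrow> par v \<notin> S \<Longrightarrow> {f (par v), f v} \<in> E"
    "card (R \<inter> f ` ({..<n} - S)) \<le> 2 * D * m"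
    "card {s \<in> S. f (par s) \<notin> A} \<le> D * m"
    "\<And>c. c \<in> C \<Longrightarrow> f (par (par c)) \<in> A \<Longrightarrow> f c = \<beta> (f (par (par c)))"
    using ex_embedding by blast
  define W where "W = {..<n} - f ` ({..<n} - S)"
  have fV: "f ` ({..<n} - S) \<subseteq> {..<n}" using f(2) V by blast
  have t_le: "t \<le> n" using PCS_subset(3) card_S by (metis card_lessThan card_mono finite_lessThan)
  have cardW: "card W = t"
    using fV PCS_subset(3) finite_S card_S t_le by (simp add: W_def card_Diff_subset card_image[OF f(1)])
  have finW: "finite W" by (simp add: W_def)
  define ch where "ch s = (if children n par s = {} then par s else the_elem (children n par s))" for s
  \<comment> \<open>a vertex may fill the slot \<open>s\<close> iff it covers \<open>e s\<close>; for a leaf both entries coincide\<close>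
  define e where "e s = (f (par s), f (ch s))" for s
  have child: "children n par s = {ch s} \<and> ch s \<in> C \<and> par (ch s) = s" if "s \<in> S" "children n par s \<noteq> {}" for s
  proof -
    have "card (children n par s) = 1" using children_cases that by auto
    then obtain c where "children n par s = {c}" by (meson card_1_singletonE)
    moreover from this have "ch s = c" by (simp add: ch_def)
    moreover have "c \<in> C" "par c = s"
      using calculation(1) that(1) by (auto simp: C_def) (auto simp: children_def)
    ultimately show ?thesis by simp
  qed
  have ch_cases: "ch s = par s \<or> ch s \<in> C \<and> par (ch s) = s" if "s \<in> S" for s
    using child[OF that] by (auto simp: ch_def)
  have par_P: "par s \<in> P" if "s \<in> S" for s using that by (simp add: P_def)
  have slot_dom: "par s \<in> {..<n} - S" "ch s \<in> {..<n} - S" if "s \<in> S" for s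
  proof -
    have "P \<union> C \<subseteq> {..<n} - S" using PCS_disjoint PCS_subset by blast
    moreover have "ch s \<in> P \<union> C" using ch_cases[OF that] par_P[OF that] by auto
    ultimately show "par s \<in> {..<n} - S" "ch s \<in> {..<n} - S" using par_P[OF that] by blast+
  qed
  have slot_disj: "{par s, ch s} \<inter> {par s', ch s'} = {}" if "s \<in> S" "s' \<in> S" "s \<noteq> s'" for s s'
  proof -
    have "par s \<noteq> par s'" using inj_par that by (meson inj_onD)
    then show ?thesis
      using ch_cases[OF that(1)] ch_cases[OF that(2)] par_P[OF that(1)] par_P[OF that(2)] PCS_disjoint(3) that(3)
      by auto
  qed
  have e_disj: "ends (e s) \<inter> ends (e s') = {}" if "s \<in> S" "s' \<in> S" "s \<noteq> s'" for s s'
    using slot_disj[OF that] slot_dom[OF that(1)] slot_dom[OF that(2)] inj_onD[OF f(1)]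
    by (auto simp: ends_def e_def)
  have inj_e: "inj_on e S"
    using e_disj by (intro inj_onI) (force simp: ends_def)
  have e_img: "ends (e s) \<subseteq> f ` ({..<n} - S)" if "s \<in> S" for s
    using slot_dom[OF that] by (auto simp: ends_def e_def)
  define N where "N s = {w \<in> W. covers E w (e s)}" for s
  have finN: "finite (\<Union> (N ` J))" for J
    by (rule finite_subset[OF _ finW]) (auto simp: N_def)
  have hall: "card J \<le> card (\<Union> (N ` J))" if J: "J \<subseteq> S" for J
  proof (rule ccontr)
    assume small: "\<not> ?thesis"
    define X where "X = e ` J"
    define Y where "Y = W - \<Union> (N ` J)"
    have finJ: "finite J" using J finite_S finite_subset by blast
    have cardX: "card X = card J" using inj_e J by (auto simp: X_def intro!: card_image intro: inj_on_subset)
    have "\<Union> (N ` J) \<subseteq> W" by (auto simp: N_def)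
    then have cardY: "card Y = t - card (\<Union> (N ` J))" "card (\<Union> (N ` J)) \<le> t"
      using finN finW cardW by (auto simp: Y_def card_Diff_subset card_mono)
    have "X \<subseteq> (f ` ({..<n} - S)) \<times> (f ` ({..<n} - S))"
      using J slot_dom unfolding X_def e_def by blast
    then have XV: "X \<subseteq> {..<n} \<times> {..<n}" using fV by blast
    have YV: "Y \<subseteq> {..<n}" by (auto simp: Y_def W_def)
    have disjX: "disjoint_pairs X"
      using J e_disj unfolding X_def disjoint_pairs_def pairwise_def by blast
    have none: "\<not> covers E w (e s)" if "w \<in> Y" "s \<in> J" for w s
      using that by (auto simp: Y_def N_def)
    have "card J \<le> t" using J finite_S card_S card_mono by blast
    \<comment> \<open>\<open>Y\<close> is the set of remaining vertices that cover no slot of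
      \<open>J\<close>; a violation of Hall's condition means \<open>card Y + card J > t\<close>.
      The sizes of \<open>J\<close> and \<open>Y\<close> decide which covering property refutes
      it.\<close>
    consider "card J \<le> m'" | "m' < card J" "m' \<le> card Y" | "m' < card J" "card Y < m'" by linarith
    then show False
    proof cases
      case 1
      have "1 \<le> card X" using small cardX by linarith
      \<comment> \<open>Of the reserve vertices that cover some slot of \<open>J\<close>, at most
        \<open>2 * D * m\<close> have been used; all others are candidates.\<close>
      then have "card J + 2 * D * m \<le> card {w \<in> R. \<exists>x\<in>X. covers E w x}"
        using cover_reserve[OF XV disjX] 1 cardX by simp
      also have "\<dots> \<le> card (\<Union> (N ` J) \<union> (R \<inter> f ` ({..<n} - S)))"
      proof (rule card_mono)
        show "{w \<in> R. \<exists>x\<in>X. covers E w x} \<subseteq> \<Union> (N ` J) \<union> (R \<inter> f ` ({..<n} - S))"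
          using parts by (auto simp: X_def N_def W_def)
      qed (use finN finite in auto)
      also have "\<dots> \<le> card (\<Union> (N ` J)) + card (R \<inter> f ` ({..<n} - S))" by (rule card_Un_le)
      finally show False using f(4) small by linarith
    next
      case 2
      have "Y \<inter> \<Union> (ends ` X) = {}" using e_img J by (auto simp: X_def Y_def W_def)
      then obtain x w where "x \<in> X" "w \<in> Y" "covers E w x"
        using cover_large[OF XV YV disjX] 2 cardX by auto
      then show False using none by (auto simp: X_def)
    next
      case 3
      have "1 \<le> card Y" using cardY small \<open>card J \<le> t\<close> by linarith
      then have "card Y + 2 * D * m \<le> card {a \<in> A. \<exists>w\<in>Y. covers E w (a, \<beta> a)}"
        using cover_designated[OF YV] 3 by simp
      \<comment> \<open>Covering the designated pair of \<open>f (par s)\<close> implies covering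
        the slot \<open>s\<close>, also for a leaf. So \<open>Y\<close> misses the designated pair
        of every slot of \<open>J\<close> whose parent lies in \<open>A\<close>.\<close>
      also have "\<dots> \<le> card (A - (\<lambda>s. f (par s)) ` {s \<in> J. f (par s) \<in> A})"
      proof (rule card_mono)
        have "\<not> covers E w (f (par s), \<beta> (f (par s)))" if s: "s \<in> J" "f (par s) \<in> A" and w: "w \<in> Y" for s w
        proof
          assume cov: "covers E w (f (par s), \<beta> (f (par s)))"
          have "s \<in> S" using s J by blast
          have "f (ch s) = f (par s) \<or> f (ch s) = \<beta> (f (par s))"
            using ch_cases[OF \<open>s \<in> S\<close>] f(6)[of "ch s"] s by auto
          then have "covers E w (e s)" using cov by (auto simp: covers_def e_def)
          then show False using none w s by blast
        qed
        then show "{a \<in> A. \<exists>w\<in>Y. covers E w (a, \<beta> a)} \<subseteq> A - (\<lambda>s. f (par s)) ` {s \<in> J. f (par s) \<in> A}"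
          by blast
      qed (use finite in auto)
      also have "\<dots> = card A - card {s \<in> J. f (par s) \<in> A}"
      proof (subst card_Diff_subset)
        have "inj_on (f \<circ> par) S"
          using inj_par f(1) slot_dom by (intro comp_inj_on) (auto intro: inj_on_subset)
        then have "inj_on (\<lambda>s. f (par s)) {s \<in> J. f (par s) \<in> A}"
          using J by (auto simp: comp_def intro: inj_on_subset)
        then show "card A - card ((\<lambda>s. f (par s)) ` {s \<in> J. f (par s) \<in> A}) = card A - card {s \<in> J. f (par s) \<in> A}"
          by (simp add: card_image)
      qed (use finJ in auto)
      finally have *: "card Y + 2 * D * m \<le> t + m - card {s \<in> J. f (par s) \<in> A}" using card_designated by simp
      have "J \<subseteq> {s \<in> J. f (par s) \<in> A} \<union> {s \<in> S. f (par s) \<notin> A}" using J by blast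
      then have "card J \<le> card ({s \<in> J. f (par s) \<in> A} \<union> {s \<in> S. f (par s) \<notin> A})"
        using finJ finite_S by (intro card_mono) auto
      also have "\<dots> \<le> card {s \<in> J. f (par s) \<in> A} + card {s \<in> S. f (par s) \<notin> A}" by (rule card_Un_le)
      finally have "card J \<le> card {s \<in> J. f (par s) \<in> A} + D * m" using f(5) by linarith
      moreover have "m \<le> D * m" using pos by simp
      moreover have "2 * D * m = D * m + D * m" by simp
      \<comment> \<open>The bounds add up to \<open>card Y + card J + D * m \<le> t + m\<close>,
        hence \<open>card Y + card J \<le> t\<close>. That \<open>Y\<close> is nonempty guards the
        truncated subtraction in \<open>*\<close>.\<close>
      ultimately show False using * cardY small \<open>card J \<le> t\<close> \<open>1 \<le> card Y\<close> by linarith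
    qed
  qed
  obtain M where M: "inj_on M S" "\<forall>s\<in>S. M s \<in> N s"
    using hall_marriage[of S N] finite_S hall finW by (auto simp: N_def)
  define F where "F v = (if v \<in> S then M v else f v)" for v
  have dom: "{..<n} = S \<union> ({..<n} - S)" using PCS_subset by blast
  have "M ` S \<inter> f ` ({..<n} - S) = {}" using M(2) by (auto simp: N_def W_def)
  then have "inj_on F (S \<union> ({..<n} - S))"
    unfolding F_def by (rule inj_on_disjoint_Un[OF M(1) f(1)])
  then have "inj_on F {..<n}" using dom by simp
  moreover have "F ` {..<n} \<subseteq> {..<n}" using M(2) fV by (auto simp: F_def N_def W_def)
  moreover have "{F (par v), F v} \<in> E" if v: "v \<in> {1..<n}" for v
  proof -
    consider "v \<in> S" | "v \<notin> S" "par v \<in> S" | "v \<notin> S" "par v \<notin> S" by blast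
    then show ?thesis
    proof cases
      case 1
      then have "covers E (M v) (e v)" "par v \<notin> S" using M(2) slot_dom by (auto simp: N_def)
      then show ?thesis using 1 by (simp add: F_def covers_def e_def insert_commute)
    next
      case 2
      then have "covers E (M (par v)) (e (par v))" using M(2) by (auto simp: N_def)
      moreover have "v \<in> children n par (par v)" using v by (simp add: children_def)
      then have "children n par (par v) \<noteq> {}" "v \<in> children n par (par v)" by auto
      then have "ch (par v) = v" using child[OF 2(2)] by auto
      ultimately show ?thesis using 2 by (simp add: F_def covers_def e_def)
    next
      case 3
      then show ?thesis using f(3) v by (simp add: F_def)
    qed
  qed
  ultimately show ?thesis using that by blast
qed

end

section \<open>Back from parent arrays to trees\<close>

lemma (in pair_expander) contains_bounded_tree:
  fixes T :: "'a sgraph"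
  assumes T: "is_tree T" "card (verts T) = n" "max_degree T \<le> D"
    and size: "4 * D * t + 3 * t + 2 \<le> n" "1 \<le> t"
  shows "contains_copy ({..<n}, E) T"
proof -
  obtain g :: "nat \<Rightarrow> 'a" and par where g: "bij_betw g {..<n} (verts T)" and par: "\<forall>i\<in>{1..<n}. par i < i"
    and edgesT: "edges T = (\<lambda>i. {g i, g (par i)}) ` {1..<n}"
    using tree_parent_array[OF T(1)] T(2) by auto
  have fin: "finite (verts T)" and sub: "edges T \<subseteq> all_pairs (verts T)"
    using T(1) by (auto simp: is_tree_def finite_sgraph_def)
  have inj: "inj_on g {..<n}" using g by (simp add: bij_betw_def)
  have deg: "card (children n par i) \<le> D" if i: "i < n" for i
  proof -
    have "{u. {g i, u} \<in> edges T} \<subseteq> verts T" using sub by (auto simp: all_pairs_def)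
    then have "finite {u. {g i, u} \<in> edges T}" using fin finite_subset by blast
    moreover have "g ` children n par i \<subseteq> {u. {g i, u} \<in> edges T}"
      unfolding edgesT by (auto simp: children_def insert_commute)
    moreover have "inj_on g (children n par i)"
      using inj by (rule inj_on_subset) (auto simp: children_def)
    ultimately have "card (children n par i) \<le> degree T (g i)"
      unfolding degree_def by (metis card_image card_mono)
    also have "\<dots> \<le> max_degree T"
      unfolding max_degree_def using fin g i by (intro Max_ge) (auto simp: bij_betw_def)
    finally show ?thesis using T(3) by simp
  qed
  then have "\<forall>i<n. card (children n par i) \<le> D" by blast
  then obtain S where S: "S \<subseteq> {1..<n}" "card S = t" "inj_on par S" "0 \<notin> par ` S" "par ` S \<inter> S = {}"
    "(\<Union>s\<in>S. children n par s) \<inter> S = {}" "(\<Union>s\<in>S. children n par s) \<inter> par ` S = {}"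
    "(\<forall>s\<in>S. children n par s = {}) \<or> (\<forall>s\<in>S. card (children n par s) = 1)"
    by (rule exists_slots[OF par _ size])
  have "slotted_tree n D t par S"
    by (unfold_locales; use S par deg in blast)
  then obtain F where F: "inj_on F {..<n}" "F ` {..<n} \<subseteq> {..<n}" "\<And>v. v \<in> {1..<n} \<Longrightarrow> {F (par v), F v} \<in> E"
    using spanning_embedding by blast
  define h where "h = F \<circ> inv_into {..<n} g"
  have hg: "h (g i) = F i" if "i < n" for i using inj that by (simp add: h_def inv_into_f_f)
  have vT: "verts T = g ` {..<n}" using g by (simp add: bij_betw_def)
  have "inj_on h (verts T)"
  proof (rule inj_onI)
    fix x y assume "x \<in> verts T" "y \<in> verts T" "h x = h y"
    then obtain i j where "x = g i" "y = g j" "i < n" "j < n" "F i = F j" using hg vT by auto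
    then show "x = y" using F(1) by (auto dest: inj_onD)
  qed
  moreover have "h ` verts T \<subseteq> {..<n}" using vT hg F(2) by auto
  moreover have "h ` ed \<in> E" if ed: "ed \<in> edges T" for ed
  proof -
    obtain i where i: "i \<in> {1..<n}" "ed = {g i, g (par i)}" using ed edgesT by auto
    then have "par i < n" using par by (meson atLeastLessThan_iff less_trans)
    then have "h ` ed = {F (par i), F i}" using i hg by auto
    then show ?thesis using F(3) i by simp
  qed
  ultimately show ?thesis unfolding contains_copy_def by (intro exI[of _ h]) auto
qed

section \<open>Uncovered pairs in the random graph\<close>

lemma prob_pair_pmf_Times:
  "measure_pmf.prob (pair_pmf M N) (A \<times> B) = measure_pmf.prob M A * measure_pmf.prob N B"
proof -
  \<comment> \<open>The product rule is applied to countable sets, so both events are first cut down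
    to the supports.\<close>
  have "measure_pmf.prob (pair_pmf M N) (A \<times> B)
      = measure_pmf.prob (pair_pmf M N) ((A \<inter> set_pmf M) \<times> (B \<inter> set_pmf N))"
    using measure_Int_set_pmf[of "pair_pmf M N" "A \<times> B"] by (simp add: Times_Int_Times)
  also have "\<dots> = measure_pmf.prob M (A \<inter> set_pmf M) * measure_pmf.prob N (B \<inter> set_pmf N)"
    by (intro measure_pmf_prob_product) (auto intro: countable_subset)
  finally show ?thesis by (simp add: measure_Int_set_pmf)
qed

text \<open>Splitting \<open>U\<close> into one block and its complement peels off an independent
  factor. A block of at most \<open>r\<close> elements is entirely true with probability at least
  \<open>p ^ r\<close>.\<close>

lemma prob_no_full_block:
  fixes F :: "'i \<Rightarrow> 'a set"
  assumes "finite U" "finite J" "\<And>j. j \<in> J \<Longrightarrow> F j \<subseteq> U" "\<And>j. j \<in> J \<Longrightarrow> card (F j) \<le> r"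
    and "disjoint_family_on F J" "0 \<le> p" "p \<le> 1"
  shows "measure_pmf.prob (Pi_pmf U False (\<lambda>_. bernoulli_pmf p)) {b. \<forall>j\<in>J. \<exists>e\<in>F j. \<not> b e}
    \<le> (1 - p ^ r) ^ card J"
  using assms(2,1,3-5)
proof (induction J arbitrary: U rule: finite_induct)
  case (insert j J)
  let ?P = "\<lambda>U. Pi_pmf U False (\<lambda>_. bernoulli_pmf p)"
  let ?ev = "\<lambda>J. {b. \<forall>j\<in>J. \<exists>e\<in>F j. \<not> b e}"
  have fin: "finite (F j)" "finite (U - F j)" using insert.prems finite_subset by (metis insertI1, blast)
  have U: "U = F j \<union> (U - F j)" using insert.prems by blast
  have FJ: "F j' \<inter> F j = {}" if "j' \<in> J" for j'
    using insert.prems(4) insert.hyps(2) that by (auto simp: disjoint_family_on_def)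
  have eq: "(\<lambda>(f, g) x. if x \<in> F j then f x else g x) -` ?ev (insert j J) = ?ev {j} \<times> ?ev J"
  proof -
    have old: "(\<forall>j'\<in>J. \<exists>e\<in>F j'. \<not> (if e \<in> F j then f e else g e)) \<longleftrightarrow> (\<forall>j'\<in>J. \<exists>e\<in>F j'. \<not> g e)" for f g
    proof (intro ball_cong bex_cong refl)
      fix j' e assume "j' \<in> J" "e \<in> F j'"
      then have "e \<notin> F j" using FJ by blast
      then show "(\<not> (if e \<in> F j then f e else g e)) \<longleftrightarrow> \<not> g e" by simp
    qed
    have new: "(\<exists>e\<in>F j. \<not> (if e \<in> F j then f e else g e)) \<longleftrightarrow> (\<exists>e\<in>F j. \<not> f e)" for f g
      by (intro bex_cong refl) simp
    show ?thesis
    proof (rule set_eqI)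
      fix z :: "('a \<Rightarrow> bool) \<times> ('a \<Rightarrow> bool)"
      obtain f g where z: "z = (f, g)" by (cases z)
      show "z \<in> (\<lambda>(f, g) x. if x \<in> F j then f x else g x) -` ?ev (insert j J) \<longleftrightarrow> z \<in> ?ev {j} \<times> ?ev J"
        using old[of f g] new[of f g] by (simp add: z del: if_split)
    qed
  qed
  have "?P U = map_pmf (\<lambda>(f, g) x. if x \<in> F j then f x else g x) (pair_pmf (?P (F j)) (?P (U - F j)))"
    using Pi_pmf_union[OF fin, of False "\<lambda>_. bernoulli_pmf p"] U by auto
  then have "measure_pmf.prob (?P U) (?ev (insert j J)) = measure_pmf.prob (pair_pmf (?P (F j)) (?P (U - F j))) (?ev {j} \<times> ?ev J)"
    by (simp only: measure_map_pmf eq)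
  also have "\<dots> = measure_pmf.prob (?P (F j)) (?ev {j}) * measure_pmf.prob (?P (U - F j)) (?ev J)"
    by (rule prob_pair_pmf_Times)
  also have "measure_pmf.prob (?P (F j)) (?ev {j}) \<le> 1 - p ^ r"
  proof -
    have "?ev {j} = UNIV - Pi (F j) (\<lambda>_. {True})" by auto
    then have "measure_pmf.prob (?P (F j)) (?ev {j}) = 1 - measure_pmf.prob (?P (F j)) (Pi (F j) (\<lambda>_. {True}))"
      using measure_pmf.prob_compl[of "Pi (F j) (\<lambda>_. {True})" "?P (F j)"] by simp
    also have "measure_pmf.prob (?P (F j)) (Pi (F j) (\<lambda>_. {True})) = p ^ card (F j)"
      using fin assms by (subst measure_Pi_pmf_Pi) (auto simp: measure_pmf_single)
    also have "1 - p ^ card (F j) \<le> 1 - p ^ r"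
      using insert.prems(3)[of j] assms by (simp add: power_decreasing)
    finally show ?thesis .
  qed
  also have "measure_pmf.prob (?P (U - F j)) (?ev J) \<le> (1 - p ^ r) ^ card J"
  proof (rule insert.IH)
    show "F j' \<subseteq> U - F j" if "j' \<in> J" for j' using FJ[OF that] insert.prems(2)[of j'] that by blast
    show "disjoint_family_on F J" using insert.prems(4) by (auto simp: disjoint_family_on_def)
  qed (use insert.prems fin in auto)
  finally show ?case using insert.hyps assms
    by (simp add: mult_left_mono mult_right_mono power_le_one)
qed simp

text \<open>Each \<open>(x, w)\<close> owns the block of edges from \<open>w\<close> to the ends of
  \<open>x\<close>. As \<open>Y\<close> avoids all ends, an edge reveals which endpoint is
  \<open>w\<close>, and disjointness of the pairs then makes the blocks disjoint. The exponent
  \<open>r\<close> is 1 for degenerate pairs and 2 in general.\<close>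

lemma prob_uncovered_pair:
  assumes X: "X \<subseteq> {..<n} \<times> {..<n}" "disjoint_pairs X" "\<And>x. x \<in> X \<Longrightarrow> card (ends x) \<le> r"
    and Y: "Y \<subseteq> {..<n}" "Y \<inter> \<Union> (ends ` X) = {}" and p: "0 \<le> p" "p \<le> 1"
  shows "measure_pmf.prob (random_graph n p) {G. \<forall>x\<in>X. \<forall>w\<in>Y. \<not> covers (edges G) w x}
    \<le> (1 - p ^ r) ^ (card X * card Y)"
proof -
  let ?U = "all_pairs {..<n}"
  define F where "F = (\<lambda>(x, w). (\<lambda>u. {w, u}) ` ends x :: nat set set)"
  have fin: "finite ?U" unfolding all_pairs_def by (rule finite_subset[of _ "Pow {..<n}"]) auto
  have finX: "finite X" using X(1) by (rule finite_subset) auto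
  have finY: "finite Y" using Y(1) by (rule finite_subset) auto
  have FU: "F j \<subseteq> ?U" if j: "j \<in> X \<times> Y" for j
  proof -
    obtain x w where "j = (x, w)" by (cases j)
    with j have xw: "j = (x, w)" "x \<in> X" "w \<in> Y" by auto
    have "{w, u} \<in> ?U" if u: "u \<in> ends x" for u
    proof -
      have "u < n" using X(1) xw u by (auto simp: ends_def)
      moreover have "w \<noteq> u" using Y(2) xw u by blast
      moreover have "w < n" using Y(1) xw by auto
      ultimately show ?thesis by (simp add: all_pairs_def)
    qed
    then show ?thesis using xw by (auto simp: F_def)
  qed
  have "{G. \<forall>x\<in>X. \<forall>w\<in>Y. \<not> covers (edges G) w x} = {G :: nat sgraph. \<forall>j\<in>X \<times> Y. \<exists>e\<in>F j. e \<notin> edges G}"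
    by (auto simp: covers_def F_def ends_def)
  then have "measure_pmf.prob (random_graph n p) {G. \<forall>x\<in>X. \<forall>w\<in>Y. \<not> covers (edges G) w x}
      = measure_pmf.prob (Pi_pmf ?U False (\<lambda>_. bernoulli_pmf p))
          {b. \<forall>j\<in>X \<times> Y. \<exists>e\<in>F j. \<not> (e \<in> ?U \<and> b e)}"
    by (simp add: random_graph_def vimage_def)
  also have "{b. \<forall>j\<in>X \<times> Y. \<exists>e\<in>F j. \<not> (e \<in> ?U \<and> b e)} = {b. \<forall>j\<in>X \<times> Y. \<exists>e\<in>F j. \<not> b e}"
    using FU by blast
  also have "measure_pmf.prob (Pi_pmf ?U False (\<lambda>_. bernoulli_pmf p)) \<dots> \<le> (1 - p ^ r) ^ card (X \<times> Y)"
  proof (rule prob_no_full_block[OF fin _ FU])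
    show "card (F j) \<le> r" if "j \<in> X \<times> Y" for j
    proof -
      obtain x w where "j = (x, w)" by (cases j)
      moreover from this have "x \<in> X" using that by simp
      ultimately show ?thesis using X(3)[of x] card_image_le[of "ends x" "\<lambda>u. {w, u}"]
        by (auto simp: F_def ends_def)
    qed
    show "disjoint_family_on F (X \<times> Y)"
      unfolding disjoint_family_on_def
    proof (intro ballI impI, rule ccontr)
      fix i j assume ij: "i \<in> X \<times> Y" "j \<in> X \<times> Y" "i \<noteq> j" "F i \<inter> F j \<noteq> {}"
      obtain x w x' w' where "i = (x, w)" "j = (x', w')" by (cases i, cases j)
      with ij have *: "i = (x, w)" "j = (x', w')" "x \<in> X" "w \<in> Y" "x' \<in> X" "w' \<in> Y" by auto
      obtain u u' where u: "u \<in> ends x" "u' \<in> ends x'" "{w, u} = {w', u'}"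
        using ij(4) * by (auto simp: F_def)
      have "u \<notin> Y" "u' \<notin> Y" using u * Y(2) by blast+
      then have "w = w'" "u = u'" using u(3) * by (auto simp: doubleton_eq_iff)
      then have "x = x'" using u X(2) * unfolding disjoint_pairs_def pairwise_def by blast
      then show False using ij * \<open>w = w'\<close> by simp
    qed
  qed (use p finX finY in auto)
  finally show ?thesis by (simp add: card_cartesian_product)
qed

text \<open>Disjointness of \<open>Y\<close> from the ends is part of the event because the
  independence of the blocks rests on it.\<close>

definition uncovered :: "(nat \<times> nat) set set \<Rightarrow> nat set set \<Rightarrow> nat sgraph set" where
  "uncovered \<X> \<Y> = {G. \<exists>X\<in>\<X>. \<exists>Y\<in>\<Y>. Y \<inter> \<Union> (ends ` X) = {} \<and> (\<forall>x\<in>X. \<forall>w\<in>Y. \<not> covers (edges G) w x)}"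

lemma prob_uncovered:
  assumes fin: "finite \<X>" "finite \<Y>"
    and X: "\<And>X. X \<in> \<X> \<Longrightarrow> X \<subseteq> {..<n} \<times> {..<n} \<and> disjoint_pairs X \<and> card X = a \<and> (\<forall>x\<in>X. card (ends x) \<le> r)"
    and Y: "\<And>Y. Y \<in> \<Y> \<Longrightarrow> Y \<subseteq> {..<n} \<and> card Y = b"
    and p: "0 \<le> p" "p \<le> 1" and N: "card \<X> * card \<Y> \<le> n ^ N"
  shows "measure_pmf.prob (random_graph n p) (uncovered \<X> \<Y>) \<le> real n ^ N * (1 - p ^ r) ^ (a * b)"
proof -
  let ?I = "{(X, Y). X \<in> \<X> \<and> Y \<in> \<Y> \<and> Y \<inter> \<Union> (ends ` X) = {}}"
  let ?ev = "\<lambda>(X, Y). {G :: nat sgraph. \<forall>x\<in>X. \<forall>w\<in>Y. \<not> covers (edges G) w x}"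
  have sub: "?I \<subseteq> \<X> \<times> \<Y>" by auto
  then have finI: "finite ?I" using fin finite_subset by blast
  have "uncovered \<X> \<Y> = (\<Union>i\<in>?I. ?ev i)" by (auto simp: uncovered_def)
  then have "measure_pmf.prob (random_graph n p) (uncovered \<X> \<Y>) \<le> (\<Sum>i\<in>?I. measure_pmf.prob (random_graph n p) (?ev i))"
    using finI by (simp add: measure_pmf.finite_measure_subadditive_finite)
  also have "\<dots> \<le> (\<Sum>i\<in>?I. (1 - p ^ r) ^ (a * b))"
  proof (rule sum_mono)
    fix i assume "i \<in> ?I"
    then obtain X' Y' where i: "i = (X', Y')" "X' \<in> \<X>" "Y' \<in> \<Y>" "Y' \<inter> \<Union> (ends ` X') = {}" by auto
    then show "measure_pmf.prob (random_graph n p) (?ev i) \<le> (1 - p ^ r) ^ (a * b)"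
      using prob_uncovered_pair[of X' n r Y' p] X[of X'] Y[of Y'] p by auto
  qed
  also have "\<dots> = real (card ?I) * (1 - p ^ r) ^ (a * b)" by simp
  also have "\<dots> \<le> real n ^ N * (1 - p ^ r) ^ (a * b)"
  proof (rule mult_right_mono)
    have "card ?I \<le> card (\<X> \<times> \<Y>)" using sub fin by (intro card_mono) auto
    also have "\<dots> \<le> n ^ N" using N by (simp add: card_cartesian_product)
    finally have "real (card ?I) \<le> real (n ^ N)" by (rule of_nat_mono)
    then show "real (card ?I) \<le> real n ^ N" by (simp only: of_nat_power)
    show "0 \<le> (1 - p ^ r) ^ (a * b)" using p by (simp add: power_le_one)
  qed
  finally show ?thesis .
qed

section \<open>Failure of expansion\<close>

definition subsets_of_card :: "'a set \<Rightarrow> nat \<Rightarrow> 'a set set" where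
  "subsets_of_card X a = {Y. Y \<subseteq> X \<and> card Y = a}"

lemma finite_subsets_of_card: "finite X \<Longrightarrow> finite (subsets_of_card X a)"
  unfolding subsets_of_card_def by simp

lemma choose_le_power: "k \<le> n \<Longrightarrow> k choose j \<le> n ^ j"
proof (cases "j \<le> k")
  case True
  assume "k \<le> n"
  then show ?thesis using binomial_le_pow[OF True] by (meson le_trans power_mono zero_le)
qed (simp add: binomial_eq_0)

lemma card_subsets_of_card:
  assumes "finite X" "card X \<le> n"
  shows "card (subsets_of_card X a) \<le> n ^ a"
  using n_subsets[OF assms(1)] choose_le_power[OF assms(2)] by (simp add: subsets_of_card_def)

text \<open>A subset is counted through the at most \<open>a\<close> elements it omits, so
  \<open>card X\<close> does not enter the exponent. This is the gain from fixing designated pairs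
  and reserve before the graph is drawn.\<close>

lemma card_co_subsets_of_card:
  assumes "finite X" "card X \<le> n" "1 \<le> n"
  shows "card (subsets_of_card X (card X - a)) \<le> n ^ a"
proof (cases "a \<le> card X")
  case True
  then show ?thesis using n_subsets[OF assms(1)] choose_le_power[OF assms(2), of a]
    by (simp add: subsets_of_card_def binomial_symmetric[OF True])
next
  case False
  then show ?thesis using n_subsets[OF assms(1), of 0] assms by (simp add: subsets_of_card_def)
qed

lemma subsets_of_card_nonempty:
  assumes "a \<le> card X"
  obtains Y where "Y \<in> subsets_of_card X a"
  using obtain_subset_with_card_n[OF assms] by (auto simp: subsets_of_card_def)

lemma card_ends_le: "card (ends x) \<le> 2"
  by (simp add: ends_def card_insert_if)

lemma card_UN_ends_le: "finite X \<Longrightarrow> card (\<Union> (ends ` X)) \<le> 2 * card X"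
proof -
  assume "finite X"
  then have "card (\<Union> (ends ` X)) \<le> (\<Sum>x\<in>X. card (ends x))" by (rule card_UN_le)
  also have "\<dots> \<le> (\<Sum>x\<in>X. 2)" by (intro sum_mono card_ends_le)
  finally show ?thesis by (simp add: mult.commute)
qed

lemma disjoint_pairs_subset: "disjoint_pairs X \<Longrightarrow> Y \<subseteq> X \<Longrightarrow> disjoint_pairs Y"
  unfolding disjoint_pairs_def by (rule pairwise_subset)

text \<open>The \<open>m\<close> of \<open>pair_expander\<close> is \<open>2 * m0\<close>, since two
  possibly overlapping sets of that size contain disjoint subsets of size \<open>m0\<close>;
  \<open>q\<close> is the excess \<open>2 * D * m\<close>. The vertex classes are consecutive
  intervals, an arbitrary choice independent of the graph.\<close>

locale expander_parameters =
  fixes n D m0 m' t r :: nat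
  assumes pos: "0 < m0" "0 < m'" "1 \<le> D"
    and fits: "2 * (t + 2 * m0) + r \<le> n" and sizes: "r + D * (2 * m0) + 3 * (2 * m0) \<le> t"
begin

abbreviation (input) "k \<equiv> t + 2 * m0"
abbreviation (input) "q \<equiv> 2 * D * (2 * m0)"
abbreviation (input) "A \<equiv> {..<k}"
abbreviation (input) "R \<equiv> {2 * k..<2 * k + r}"
abbreviation (input) "\<beta> \<equiv> (\<lambda>a. a + k)"

text \<open>Degenerate pairs turn plain edge expansion into a covering statement.\<close>

definition loops :: "(nat \<times> nat) set set" where
  "loops = (\<lambda>X. (\<lambda>x. (x, x)) ` X) ` subsets_of_card {..<n} m0"

text \<open>The number \<open>2 * s + q\<close> bounds the loss: fewer than \<open>s + q\<close>
  covered pairs and at most \<open>s\<close> pairs that meet \<open>Y\<close>.\<close>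

definition designated :: "nat \<Rightarrow> (nat \<times> nat) set set" where
  "designated s = (\<lambda>X. (\<lambda>a. (a, \<beta> a)) ` X) ` subsets_of_card A (k - (2 * s + q))"

definition pair_sets :: "nat \<Rightarrow> (nat \<times> nat) set set" where
  "pair_sets s = {X \<in> subsets_of_card ({..<n} \<times> {..<n}) s. disjoint_pairs X}"

text \<open>In the last event, \<open>3 * s + q\<close> bounds the reserve vertices lost: fewer than
  \<open>s + q\<close> that cover something and at most \<open>2 * s\<close> that are ends of
  \<open>X\<close>.\<close>

definition failure :: "nat sgraph set" where
  "failure = uncovered loops (subsets_of_card {..<n} m0) \<union>
     uncovered (pair_sets m') (subsets_of_card {..<n} m') \<union>
     (\<Union>s\<in>{1..m'}. uncovered (designated s) (subsets_of_card {..<n} s)) \<union>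
     (\<Union>s\<in>{1..m'}. uncovered (pair_sets s) (subsets_of_card R (r - (3 * s + q))))"

text \<open>If a property fails, discarding whatever is covered or meets the other set leaves sets
  \<open>X\<close> and \<open>Y\<close> with no covering at all, of the sizes listed in
  \<open>failure\<close>.\<close>

lemma not_failure_imp_pair_expander:
  assumes G: "G \<notin> failure"
  shows "pair_expander n D (2 * m0) m' t (edges G) A R \<beta>"
proof
  have found: "\<exists>x\<in>X. \<exists>w\<in>Y. covers (edges G) w x"
    if "G \<notin> uncovered \<X> \<Y>" "X \<in> \<X>" "Y \<in> \<Y>" "Y \<inter> \<Union> (ends ` X) = {}" for \<X> \<Y> X Y
    using that unfolding uncovered_def by blast
  show "\<exists>x\<in>X. \<exists>y\<in>Y. {x, y} \<in> edges G"
    if XY: "X \<subseteq> {..<n}" "Y \<subseteq> {..<n}" "2 * m0 \<le> card X" "2 * m0 \<le> card Y" for X Y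
  proof -
    have "m0 \<le> card Y" using XY by simp
    then obtain Y' where Y': "Y' \<in> subsets_of_card Y m0" by (rule subsets_of_card_nonempty)
    have finY': "finite Y'" using Y' pos by (auto simp: subsets_of_card_def intro: card_ge_0_finite)
    have "card X - card Y' \<le> card (X - Y')" by (rule diff_card_le_card_Diff[OF finY'])
    then have "m0 \<le> card (X - Y')" using Y' XY by (simp add: subsets_of_card_def)
    then obtain X' where X': "X' \<in> subsets_of_card (X - Y') m0" by (rule subsets_of_card_nonempty)
    have "\<exists>x\<in>(\<lambda>x. (x, x)) ` X'. \<exists>w\<in>Y'. covers (edges G) w x"
    proof (rule found)
      show "G \<notin> uncovered loops (subsets_of_card {..<n} m0)" using G by (simp add: failure_def)
      have "X' \<in> subsets_of_card {..<n} m0" using X' XY by (auto simp: subsets_of_card_def)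
      then show "(\<lambda>x. (x, x)) ` X' \<in> loops" by (auto simp: loops_def)
      show "Y' \<in> subsets_of_card {..<n} m0" using Y' XY by (auto simp: subsets_of_card_def)
      show "Y' \<inter> \<Union> (ends ` (\<lambda>x. (x, x)) ` X') = {}" using X' by (auto simp: ends_def subsets_of_card_def)
    qed
    then show ?thesis using X' Y' by (force simp: covers_def subsets_of_card_def insert_commute)
  qed
  show "card Y + 2 * D * (2 * m0) \<le> card {a \<in> A. \<exists>w\<in>Y. covers (edges G) w (a, \<beta> a)}"
    if Y: "Y \<subseteq> {..<n}" "1 \<le> card Y" "card Y \<le> m'" for Y
  proof (rule ccontr)
    assume less: "\<not> ?thesis"
    let ?cov = "{a \<in> A. \<exists>w\<in>Y. covers (edges G) w (a, \<beta> a)}"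
    let ?hit = "{a \<in> A. a \<in> Y \<or> \<beta> a \<in> Y}"
    have finY: "finite Y" using Y(1) finite_subset by blast
    \<comment> \<open>\<open>A\<close> and its partners are disjoint intervals, so different pairs
      are hit in different elements of \<open>Y\<close>.\<close>
    have "card ?hit \<le> card Y"
      using finY by (intro card_inj_on_le[of "\<lambda>a. if a \<in> Y then a else \<beta> a"]) (auto simp: inj_on_def)
    moreover have "card (?cov \<union> ?hit) \<le> card ?cov + card ?hit" by (rule card_Un_le)
    moreover have "card A - card (?cov \<union> ?hit) \<le> card (A - (?cov \<union> ?hit))"
      by (rule diff_card_le_card_Diff) simp
    ultimately have "k - (2 * card Y + q) \<le> card (A - (?cov \<union> ?hit))" using less by simp
    then obtain X where X: "X \<in> subsets_of_card (A - (?cov \<union> ?hit)) (k - (2 * card Y + q))"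
      by (rule subsets_of_card_nonempty)
    have "\<exists>x\<in>(\<lambda>a. (a, \<beta> a)) ` X. \<exists>w\<in>Y. covers (edges G) w x"
    proof (rule found)
      show "G \<notin> uncovered (designated (card Y)) (subsets_of_card {..<n} (card Y))"
        using G Y by (simp add: failure_def)
      have "X \<in> subsets_of_card A (k - (2 * card Y + q))" using X by (auto simp: subsets_of_card_def)
      then show "(\<lambda>a. (a, \<beta> a)) ` X \<in> designated (card Y)" by (auto simp: designated_def)
      show "Y \<in> subsets_of_card {..<n} (card Y)" using Y by (simp add: subsets_of_card_def)
      show "Y \<inter> \<Union> (ends ` (\<lambda>a. (a, \<beta> a)) ` X) = {}" using X by (auto simp: ends_def subsets_of_card_def)
    qed
    then show False using X by (auto simp: subsets_of_card_def)
  qed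
  show "card X + 2 * D * (2 * m0) \<le> card {w \<in> R. \<exists>x\<in>X. covers (edges G) w x}"
    if X: "X \<subseteq> {..<n} \<times> {..<n}" "disjoint_pairs X" "1 \<le> card X" "card X \<le> m'" for X
  proof (rule ccontr)
    assume less: "\<not> ?thesis"
    let ?cov = "{w \<in> R. \<exists>x\<in>X. covers (edges G) w x}"
    have finX: "finite X" using X(3) by (auto intro: card_ge_0_finite)
    have "finite (\<Union> (ends ` X))" using finX by (auto simp: ends_def)
    then have "card R - card (?cov \<union> \<Union> (ends ` X)) \<le> card (R - (?cov \<union> \<Union> (ends ` X)))"
      by (intro diff_card_le_card_Diff) simp
    moreover have "card (?cov \<union> \<Union> (ends ` X)) \<le> card ?cov + card (\<Union> (ends ` X))" by (rule card_Un_le)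
    moreover have "card (\<Union> (ends ` X)) \<le> 2 * card X" by (rule card_UN_ends_le[OF finX])
    moreover have "card R = r" by simp
    ultimately have "r - (3 * card X + q) \<le> card (R - (?cov \<union> \<Union> (ends ` X)))" using less by linarith
    then obtain Y where Y: "Y \<in> subsets_of_card (R - (?cov \<union> \<Union> (ends ` X))) (r - (3 * card X + q))"
      by (rule subsets_of_card_nonempty)
    have "\<exists>x\<in>X. \<exists>w\<in>Y. covers (edges G) w x"
    proof (rule found)
      show "G \<notin> uncovered (pair_sets (card X)) (subsets_of_card R (r - (3 * card X + q)))"
        using G X by (simp add: failure_def)
      show "X \<in> pair_sets (card X)" using X by (simp add: pair_sets_def subsets_of_card_def)
      show "Y \<in> subsets_of_card R (r - (3 * card X + q))" using Y by (auto simp: subsets_of_card_def)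
      show "Y \<inter> \<Union> (ends ` X) = {}" using Y by (auto simp: subsets_of_card_def)
    qed
    then show False using Y by (auto simp: subsets_of_card_def)
  qed
  show "\<exists>x\<in>X. \<exists>w\<in>Y. covers (edges G) w x"
    if XY: "X \<subseteq> {..<n} \<times> {..<n}" "Y \<subseteq> {..<n}" "disjoint_pairs X" "m' \<le> card X" "m' \<le> card Y"
      "Y \<inter> \<Union> (ends ` X) = {}" for X Y
  proof -
    obtain X' where X': "X' \<in> subsets_of_card X m'" using XY(4) by (rule subsets_of_card_nonempty)
    obtain Y' where Y': "Y' \<in> subsets_of_card Y m'" using XY(5) by (rule subsets_of_card_nonempty)
    have "\<exists>x\<in>X'. \<exists>w\<in>Y'. covers (edges G) w x"
    proof (rule found)
      show "G \<notin> uncovered (pair_sets m') (subsets_of_card {..<n} m')" using G by (simp add: failure_def)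
      have "X' \<subseteq> X" "card X' = m'" using X' by (auto simp: subsets_of_card_def)
      then show "X' \<in> pair_sets m'"
        using XY disjoint_pairs_subset[of X X'] by (auto simp: subsets_of_card_def pair_sets_def)
      show "Y' \<in> subsets_of_card {..<n} m'" using Y' XY by (auto simp: subsets_of_card_def)
      show "Y' \<inter> \<Union> (ends ` X') = {}" using X' Y' XY(6) by (auto simp: subsets_of_card_def)
    qed
    then show ?thesis using X' Y' by (auto simp: subsets_of_card_def)
  qed
  show "card R + D * (2 * m0) + 3 * (2 * m0) \<le> t" using sizes by simp
qed (use pos fits in auto)

text \<open>The exponents of \<open>n\<close> count choices: \<open>m0 + m0\<close>;
  \<open>2 * m' + m'\<close>, as a pair costs two vertices; \<open>(2 * s + q) + s\<close> and
  \<open>2 * s + (3 * s + q)\<close>, where the subsets of \<open>A\<close> and of \<open>R\<close>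
  are counted by their complements.\<close>

lemma prob_failure:
  assumes p: "0 \<le> p" "p \<le> 1"
  shows "measure_pmf.prob (random_graph n p) failure \<le>
    real n ^ (2 * m0) * (1 - p) ^ (m0 * m0) + real n ^ (3 * m') * (1 - p\<^sup>2) ^ (m' * m') +
    (\<Sum>s\<in>{1..m'}. real n ^ (3 * s + q) * (1 - p\<^sup>2) ^ ((k - (2 * s + q)) * s)) +
    (\<Sum>s\<in>{1..m'}. real n ^ (5 * s + q) * (1 - p\<^sup>2) ^ (s * (r - (3 * s + q))))"
proof -
  have n1: "1 \<le> n" using fits pos by simp
  let ?pr = "\<lambda>X. measure_pmf.prob (random_graph n p) X"
  have fin_ps: "finite (pair_sets s)" for s by (simp add: pair_sets_def finite_subsets_of_card)
  have card_V: "card (subsets_of_card {..<n} s) \<le> n ^ s" for s by (rule card_subsets_of_card) auto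
  have card_ps: "card (pair_sets s) \<le> n ^ (2 * s)" for s
  proof -
    have "card (pair_sets s) \<le> card (subsets_of_card ({..<n} \<times> {..<n}) s)"
      by (intro card_mono) (auto simp: pair_sets_def finite_subsets_of_card)
    also have "\<dots> \<le> (n * n) ^ s" by (rule card_subsets_of_card) (auto simp: card_cartesian_product)
    finally show ?thesis by (simp add: power_mult power2_eq_square)
  qed
  have 1: "?pr (uncovered loops (subsets_of_card {..<n} m0)) \<le> real n ^ (2 * m0) * (1 - p ^ 1) ^ (m0 * m0)"
  proof (rule prob_uncovered)
    show "X \<subseteq> {..<n} \<times> {..<n} \<and> disjoint_pairs X \<and> card X = m0 \<and> (\<forall>x\<in>X. card (ends x) \<le> 1)" if "X \<in> loops" for X
    proof -
      obtain Z where "X = (\<lambda>x. (x, x)) ` Z" "Z \<subseteq> {..<n}" "card Z = m0"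
        using \<open>X \<in> loops\<close> by (auto simp: loops_def subsets_of_card_def)
      then show ?thesis by (auto simp: disjoint_pairs_def pairwise_def ends_def card_image inj_on_def)
    qed
    have "card loops \<le> n ^ m0"
      unfolding loops_def using card_image_le card_V by (meson finite_lessThan finite_subsets_of_card le_trans)
    then have "card loops * card (subsets_of_card {..<n} m0) \<le> n ^ m0 * n ^ m0" using card_V by (rule mult_le_mono)
    then show "card loops * card (subsets_of_card {..<n} m0) \<le> n ^ (2 * m0)"
      by (simp add: power_add[symmetric] mult_2)
  qed (use p in \<open>auto simp: loops_def finite_subsets_of_card\<close>, auto simp: subsets_of_card_def)
  have 2: "?pr (uncovered (pair_sets m') (subsets_of_card {..<n} m')) \<le> real n ^ (3 * m') * (1 - p\<^sup>2) ^ (m' * m')"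
  proof (rule prob_uncovered[OF fin_ps])
    have "card (pair_sets m') * card (subsets_of_card {..<n} m') \<le> n ^ (2 * m') * n ^ m'"
      using card_ps card_V by (rule mult_le_mono)
    then show "card (pair_sets m') * card (subsets_of_card {..<n} m') \<le> n ^ (3 * m')"
      by (simp add: power_add[symmetric])
  qed (use p card_ends_le in \<open>auto simp: pair_sets_def finite_subsets_of_card\<close>, auto simp: subsets_of_card_def)
  have 3: "?pr (uncovered (designated s) (subsets_of_card {..<n} s))
      \<le> real n ^ (3 * s + q) * (1 - p\<^sup>2) ^ ((k - (2 * s + q)) * s)" for s
  proof (rule prob_uncovered)
    show "X \<subseteq> {..<n} \<times> {..<n} \<and> disjoint_pairs X \<and> card X = k - (2 * s + q) \<and> (\<forall>x\<in>X. card (ends x) \<le> 2)"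
      if "X \<in> designated s" for X
    proof -
      obtain Z where Z: "X = (\<lambda>a. (a, \<beta> a)) ` Z" "Z \<subseteq> A" "card Z = k - (2 * s + q)"
        using \<open>X \<in> designated s\<close> by (auto simp: designated_def subsets_of_card_def)
      have "card X = card Z" unfolding Z(1) by (rule card_image) (simp add: inj_on_def)
      moreover have "X \<subseteq> {..<n} \<times> {..<n}" using Z fits by auto
      moreover have "disjoint_pairs X" using Z by (auto simp: disjoint_pairs_def pairwise_def ends_def)
      ultimately show ?thesis using Z(3) by (simp add: card_ends_le)
    qed
    have "card (designated s) \<le> card (subsets_of_card A (k - (2 * s + q)))"
      unfolding designated_def by (rule card_image_le) (simp add: finite_subsets_of_card)
    also have "\<dots> \<le> n ^ (2 * s + q)"
      using card_co_subsets_of_card[of A n "2 * s + q"] fits n1 by simp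
    finally have "card (designated s) * card (subsets_of_card {..<n} s) \<le> n ^ (2 * s + q) * n ^ s"
      using card_V by (rule mult_le_mono)
    also have "\<dots> = n ^ (3 * s + q)" by (simp add: power_add[symmetric])
    finally show "card (designated s) * card (subsets_of_card {..<n} s) \<le> n ^ (3 * s + q)" .
  qed (use p in \<open>auto simp: designated_def finite_subsets_of_card\<close>, auto simp: subsets_of_card_def)
  have 4: "?pr (uncovered (pair_sets s) (subsets_of_card R (r - (3 * s + q))))
      \<le> real n ^ (5 * s + q) * (1 - p\<^sup>2) ^ (s * (r - (3 * s + q)))" for s
  proof (rule prob_uncovered[OF fin_ps])
    have "card (subsets_of_card R (r - (3 * s + q))) \<le> n ^ (3 * s + q)"
      using card_co_subsets_of_card[of R n "3 * s + q"] fits n1 by simp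
    then have "card (pair_sets s) * card (subsets_of_card R (r - (3 * s + q))) \<le> n ^ (2 * s) * n ^ (3 * s + q)"
      using card_ps by (intro mult_le_mono)
    also have "\<dots> = n ^ (5 * s + q)" by (simp add: power_add[symmetric])
    finally show "card (pair_sets s) * card (subsets_of_card R (r - (3 * s + q))) \<le> n ^ (5 * s + q)" .
    show "Y \<subseteq> {..<n} \<and> card Y = r - (3 * s + q)" if "Y \<in> subsets_of_card R (r - (3 * s + q))" for Y
      using that fits by (auto simp: subsets_of_card_def)
  qed (use p card_ends_le in \<open>auto simp: pair_sets_def finite_subsets_of_card\<close>, auto simp: subsets_of_card_def)
  have un: "?pr (X \<union> Y) \<le> x + y" if "?pr X \<le> x" "?pr Y \<le> y" for X Y x y
    using measure_Un_le[of X "measure_pmf (random_graph n p)" Y] that by simp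
  have UN: "?pr (\<Union>s\<in>{1..m'}. X s) \<le> (\<Sum>s\<in>{1..m'}. x s)" if "\<And>s. ?pr (X s) \<le> x s" for X x
  proof -
    have "?pr (\<Union>s\<in>{1..m'}. X s) \<le> (\<Sum>s\<in>{1..m'}. ?pr (X s))"
      by (rule measure_pmf.finite_measure_subadditive_finite) auto
    also have "\<dots> \<le> (\<Sum>s\<in>{1..m'}. x s)" using that by (intro sum_mono)
    finally show ?thesis .
  qed
  show ?thesis unfolding failure_def
    using 1 by (intro un UN 2 3 4) simp
qed

end

section \<open>Choice of parameters\<close>

lemma power_times_power_le_exp:
  assumes "1 \<le> n" "0 \<le> z" "z \<le> 1"
  shows "real n ^ a * (1 - z) ^ N \<le> exp (real a * ln (real n) - z * real N)"
proof -
  have "(1 - z) ^ N \<le> exp (- z) ^ N"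
    using assms exp_ge_add_one_self[of "- z"] by (intro power_mono) auto
  also have "\<dots> = exp (- (z * real N))" by (simp add: exp_of_nat_mult[symmetric] mult.commute)
  finally have "(1 - z) ^ N \<le> exp (- (z * real N))" .
  moreover have "real n ^ a = exp (real a * ln (real n))"
    using assms by (simp add: exp_of_nat_mult)
  ultimately show ?thesis
    by (simp add: exp_diff exp_minus divide_inverse mult_left_mono)
qed

text \<open>The constants beat the number of choices with something to spare: 3 = 2 + 1 and 4 = 3 +
  1 leave a factor 1/n, and 7 = 5 + 2 leaves 1/n^2, since up to \<open>m' \<le> n\<close> such terms
  are summed.\<close>

lemma (in expander_parameters) prob_failure_le:
  assumes p: "0 \<le> p" "p \<le> 1"
    and m0: "3 * ln (real n) \<le> p * real m0" and m': "4 * ln (real n) \<le> p\<^sup>2 * real m'" "m' \<le> n"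
    and half: "real (3 * m' + 4 * D * m0) \<le> real r / 2"
    and r: "real (4 * D * m0 + 7) * ln (real n) \<le> p\<^sup>2 * (real r / 2)"
  shows "measure_pmf.prob (random_graph n p) failure \<le> 4 / real n"
proof -
  define L where "L = ln (real n)"
  let ?q = "2 * D * (2 * m0)"
  have n1: "1 \<le> n" using fits pos by simp
  have L0: "0 \<le> L" using n1 by (simp add: L_def)
  have p2: "0 \<le> p\<^sup>2" "p\<^sup>2 \<le> 1" using p by (auto simp: power_le_one)
  have exp1: "exp (- L) = 1 / real n" using n1 by (simp add: L_def exp_minus divide_inverse)
  have "exp (- (2 * L)) = exp (- L) * exp (- L)" by (simp add: exp_add[symmetric])
  then have exp2: "exp (- (2 * L)) = 1 / (real n * real n)" unfolding exp1 by simp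
  have t1: "real n ^ (2 * m0) * (1 - p) ^ (m0 * m0) \<le> 1 / real n"
  proof -
    have "3 * L * real m0 \<le> p * real m0 * real m0" using m0 by (intro mult_right_mono) (auto simp: L_def)
    moreover have "L * 1 \<le> L * real m0" using L0 pos by (intro mult_left_mono) auto
    ultimately have "real (2 * m0) * L - p * real (m0 * m0) \<le> - L" by (simp add: algebra_simps)
    then show ?thesis
      using power_times_power_le_exp[OF n1 p, of "2 * m0" "m0 * m0"] exp1 unfolding L_def[symmetric]
      by (metis exp_le_cancel_iff order_trans)
  qed
  have t2: "real n ^ (3 * m') * (1 - p\<^sup>2) ^ (m' * m') \<le> 1 / real n"
  proof -
    have "4 * L * real m' \<le> p\<^sup>2 * real m' * real m'" using m' by (intro mult_right_mono) (auto simp: L_def)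
    moreover have "L * 1 \<le> L * real m'" using L0 pos by (intro mult_left_mono) auto
    ultimately have "real (3 * m') * L - p\<^sup>2 * real (m' * m') \<le> - L" by (simp add: algebra_simps)
    then show ?thesis
      using power_times_power_le_exp[OF n1 p2, of "3 * m'" "m' * m'"] exp1 unfolding L_def[symmetric]
      by (metis exp_le_cancel_iff order_trans)
  qed
  have t34: "real n ^ a * (1 - p\<^sup>2) ^ N \<le> 1 / (real n * real n)"
    if s: "s \<in> {1..m'}" and a: "a \<le> 5 * s + ?q" and N: "real s * (real r / 2) \<le> real N" for s a N
  proof -
    have "real s * (real (?q + 7) * L) \<le> real s * (p\<^sup>2 * (real r / 2))"
      using r by (intro mult_left_mono) (auto simp: L_def algebra_simps)
    also have "\<dots> = p\<^sup>2 * (real s * (real r / 2))" by simp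
    also have "\<dots> \<le> p\<^sup>2 * real N" using N p2 by (intro mult_left_mono) auto
    finally have 1: "real s * (real (?q + 7) * L) \<le> p\<^sup>2 * real N" .
    \<comment> \<open>As \<open>s\<close> is at least 1, \<open>s\<close> copies of
      \<open>?q + 7\<close> pay for the fixed cost \<open>?q\<close> and for two extra
      units.\<close>
    have "5 * s + ?q + 2 \<le> s * (?q + 7)"
    proof -
      obtain s' where s': "s = Suc s'" using s by (cases s) auto
      show ?thesis unfolding s' by (simp add: algebra_simps)
    qed
    then have "a + 2 \<le> s * (?q + 7)" using a by linarith
    then have "real (a + 2) * L \<le> real (s * (?q + 7)) * L" using L0 by (intro mult_right_mono) (auto simp only: of_nat_le_iff)
    then have "real a * L - p\<^sup>2 * real N \<le> - (2 * L)" using 1 by (simp add: algebra_simps)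
    then show ?thesis
      using power_times_power_le_exp[OF n1 p2, of a N] exp2 unfolding L_def[symmetric]
      by (metis exp_le_cancel_iff order_trans)
  qed
  \<comment> \<open>By \<open>half\<close>, at least \<open>r / 2\<close> elements survive the
    trimming of \<open>R\<close>, and likewise of \<open>A\<close>, which is at least as
    large.\<close>
  have len: "real r / 2 \<le> real (r - (3 * s + ?q))" "real r / 2 \<le> real (t + 2 * m0 - (2 * s + ?q))"
    if "s \<in> {1..m'}" for s
  proof -
    have s: "real (3 * s + ?q) \<le> real (3 * m' + 4 * D * m0)"
      using that by (intro of_nat_mono) simp
    then show "real r / 2 \<le> real (r - (3 * s + ?q))" using half by linarith
    have "real r \<le> real t" using sizes by (intro of_nat_mono) linarith
    then show "real r / 2 \<le> real (t + 2 * m0 - (2 * s + ?q))" using half s by linarith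
  qed
  have "(\<Sum>s\<in>{1..m'}. real n ^ (3 * s + ?q) * (1 - p\<^sup>2) ^ ((t + 2 * m0 - (2 * s + ?q)) * s)) \<le> (\<Sum>s\<in>{1..m'}. 1 / (real n * real n))"
  proof (rule sum_mono)
    fix s assume s: "s \<in> {1..m'}"
    have "real s * (real r / 2) \<le> real s * real (t + 2 * m0 - (2 * s + ?q))"
      using len[OF s] by (intro mult_left_mono) auto
    then show "real n ^ (3 * s + ?q) * (1 - p\<^sup>2) ^ ((t + 2 * m0 - (2 * s + ?q)) * s) \<le> 1 / (real n * real n)"
    proof (intro t34[OF s])
      assume "real s * (real r / 2) \<le> real s * real (t + 2 * m0 - (2 * s + ?q))"
      then show "real s * (real r / 2) \<le> real ((t + 2 * m0 - (2 * s + ?q)) * s)"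
        by (simp only: of_nat_mult mult.commute[of _ "real s"])
    qed simp
  qed
  moreover have "(\<Sum>s\<in>{1..m'}. real n ^ (5 * s + ?q) * (1 - p\<^sup>2) ^ (s * (r - (3 * s + ?q)))) \<le> (\<Sum>s\<in>{1..m'}. 1 / (real n * real n))"
  proof (rule sum_mono)
    fix s assume s: "s \<in> {1..m'}"
    have "real s * (real r / 2) \<le> real s * real (r - (3 * s + ?q))"
      using len[OF s] by (intro mult_left_mono) auto
    then show "real n ^ (5 * s + ?q) * (1 - p\<^sup>2) ^ (s * (r - (3 * s + ?q))) \<le> 1 / (real n * real n)"
    proof (intro t34[OF s])
      assume "real s * (real r / 2) \<le> real s * real (r - (3 * s + ?q))"
      then show "real s * (real r / 2) \<le> real (s * (r - (3 * s + ?q)))"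
        by (simp only: of_nat_mult)
    qed simp
  qed
  moreover have "(\<Sum>s\<in>{1..m'}. 1 / (real n * real n)) \<le> 1 / real n"
    using m'(2) n1 by (simp add: field_simps)
  moreover have "1 / real n + 1 / real n + 1 / real n + 1 / real n = 4 / real n" by simp
  ultimately show ?thesis using prob_failure[OF p] t1 t2 by linarith
qed

text \<open>With \<open>x\<close> the cube root of \<open>n\<close>, all sizes are compared with
  powers of \<open>x\<close>: \<open>D * m0\<close> is at most \<open>4 * x\<close>,
  \<open>m'\<close> at most x^2/100 + 1, while \<open>t\<close> and \<open>r\<close> have order
  x^3/D. From \<open>p \<le> 1\<close> follows \<open>D * L \<le> x\<close>, hence x^3/D is at least
  200 x^2 and dominates the error terms.\<close>

lemma parameters_exist:
  fixes n D :: nat and p :: real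
  defines "L \<equiv> ln (real n)" and "x \<equiv> real n powr (1/3)"
  assumes L: "200 \<le> L" and x: "100000 \<le> x" and D: "L / 2 \<le> real D" and p: "real D * L / x \<le> p" "p \<le> 1"
  obtains m0 m' t r where "expander_parameters n D m0 m' t r"
    "3 * L \<le> p * real m0" "4 * L \<le> p\<^sup>2 * real m'" "m' \<le> n"
    "real (3 * m' + 4 * D * m0) \<le> real r / 2" "real (4 * D * m0 + 7) * L \<le> p\<^sup>2 * (real r / 2)"
    "4 * D * t + 3 * t + 2 \<le> n" "1 \<le> t"
proof -
  have n_pos: "0 < n" using L by (cases n) (auto simp: L_def)
  have n: "real n = x ^ 3" using n_pos by (simp add: x_def powr_power)
  have x0: "0 < x" and D100: "100 \<le> real D" using x L D by linarith+
  have "real D * L / x \<le> 1" using p by linarith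
  then have DL: "real D * L \<le> x" using x0 by (simp add: pos_divide_le_eq)
  have pos: "0 < real D * L" using D100 L by simp
  have p0: "0 < p" using p(1) pos x0 by (meson divide_pos_pos less_le_trans)
  have ceil: "\<exists>k::nat. z \<le> real k \<and> real k \<le> z + 1" if "0 \<le> z" for z :: real
    using that by (intro exI[of _ "nat \<lceil>z\<rceil>"]) linarith
  have floor: "\<exists>k::nat. z - 1 \<le> real k \<and> real k \<le> z" if "0 \<le> z" for z :: real
    using that by (intro exI[of _ "nat \<lfloor>z\<rfloor>"]) linarith
  obtain m0 :: nat where m0: "3 * L / p \<le> real m0" "real m0 \<le> 3 * L / p + 1"
    using ceil[of "3 * L / p"] L p0 by auto
  obtain m' :: nat where m': "4 * L / p\<^sup>2 \<le> real m'" "real m' \<le> 4 * L / p\<^sup>2 + 1"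
    using ceil[of "4 * L / p\<^sup>2"] L p0 by auto
  \<comment> \<open>The search for slots needs a little more than \<open>4 * D * t\<close> vertices;
    20 is a comfortable choice. Taking \<open>r\<close> as a quarter of \<open>t\<close> leaves room
    for the terms in \<open>m0\<close>.\<close>
  obtain t :: nat where t: "x ^ 3 / (20 * real D) - 1 \<le> real t" "real t \<le> x ^ 3 / (20 * real D)"
    using floor[of "x ^ 3 / (20 * real D)"] x0 by auto
  obtain r :: nat where r: "real t / 4 - 1 \<le> real r" "real r \<le> real t / 4"
    using floor[of "real t / 4"] by auto
  have Lp: "L / p \<le> x / real D"
  proof -
    have "real D * L \<le> p * x" using p(1) x0 by (simp add: field_simps)
    then show ?thesis using p0 D100 by (simp add: field_simps)
  qed
  have Dx: "200 * real D \<le> x"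
  proof -
    have "200 * real D \<le> L * real D" using L by (intro mult_right_mono) auto
    then show ?thesis using DL by (simp add: mult.commute)
  qed
  have Dm0: "real D * real m0 \<le> 4 * x"
  proof -
    have "real D * real m0 \<le> real D * (3 * (x / real D) + 1)"
      using m0(2) Lp by (intro mult_left_mono) auto
    also have "\<dots> = 3 * x + real D" using D100 by (simp add: field_simps)
    finally show ?thesis using Dx x0 by linarith
  qed
  have m0x: "100 * real m0 \<le> 4 * x"
  proof -
    have "100 * real m0 \<le> real D * real m0" using D100 by (intro mult_right_mono) auto
    then show ?thesis using Dm0 by linarith
  qed
  have m'x: "real m' \<le> x\<^sup>2 / 100 + 1"
  proof -
    \<comment> \<open>A factor \<open>L\<close> is given away to reach the square of
      \<open>L / p\<close>.\<close>
    have "L * (L / p\<^sup>2) = (L / p)\<^sup>2" by (simp add: power2_eq_square)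
    also have "\<dots> \<le> (x / real D)\<^sup>2" using Lp L p0 by (intro power_mono) auto
    also have "\<dots> \<le> (x / 100)\<^sup>2" using D100 x0 by (intro power_mono divide_left_mono) auto
    finally have "L * (L / p\<^sup>2) \<le> x\<^sup>2 / 10000" by (simp add: power_divide)
    moreover have "1 * (L / p\<^sup>2) \<le> L * (L / p\<^sup>2)" using L p0 by (intro mult_right_mono) auto
    ultimately have "L / p\<^sup>2 \<le> x\<^sup>2 / 10000" by linarith
    moreover have "4 * L / p\<^sup>2 = 4 * (L / p\<^sup>2)" by simp
    moreover have "0 \<le> x\<^sup>2" by simp
    ultimately show ?thesis using m'(2) by linarith
  qed
  have xx: "100000 * x \<le> x\<^sup>2" using x x0 by (simp add: power2_eq_square mult_right_mono)
  have xxx: "100000 * x\<^sup>2 \<le> x ^ 3"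
    using x x0 by (simp add: power2_eq_square power3_eq_cube mult_right_mono)
  have xD0: "200 * x\<^sup>2 \<le> x ^ 3 / real D"
  proof -
    have "200 * x\<^sup>2 * real D \<le> x\<^sup>2 * x"
      using mult_left_mono[OF Dx, of "x\<^sup>2"] by (simp add: algebra_simps)
    then show ?thesis using D100 by (simp add: field_simps power2_eq_square power3_eq_cube)
  qed
  \<comment> \<open>Naming the quotient makes it an atom for linear arithmetic.\<close>
  define w where "w = x ^ 3 / real D"
  have xD: "200 * x\<^sup>2 \<le> w" using xD0 by (simp add: w_def)
  have "w \<le> x ^ 3 / 100" using D100 x0 unfolding w_def by (intro divide_left_mono) auto
  then have xD': "w \<le> x ^ 3 * (1 / 100)" by simp
  have tD: "x ^ 3 / (20 * real D) = w * (1 / 20)" by (simp add: w_def)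
  have sum1: "2 * real t + 4 * real m0 + real r \<le> x ^ 3"
    using t(2) r(2) m0x xD' xx xxx x unfolding tD by linarith
  have sum2: "real r + 2 * (real D * real m0) + 6 * real m0 \<le> real t"
    using t(1) r(2) m0x Dm0 xD xx x unfolding tD by linarith
  have "expander_parameters n D m0 m' t r"
  proof
    show "0 < m0" "0 < m'"
      using m0(1) m'(1) L p0 by (auto intro!: Nat.gr0I simp: divide_le_0_iff power2_eq_square mult_le_0_iff)
    show "1 \<le> D" using D100 by linarith
    have "real (2 * (t + 2 * m0) + r) \<le> real n" using sum1 n by simp
    then show "2 * (t + 2 * m0) + r \<le> n" by (simp only: of_nat_le_iff)
    have "real (r + D * (2 * m0) + 3 * (2 * m0)) \<le> real t" using sum2 by simp
    then show "r + D * (2 * m0) + 3 * (2 * m0) \<le> t" by (simp only: of_nat_le_iff)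
  qed
  moreover have "3 * L \<le> p * real m0" "4 * L \<le> p\<^sup>2 * real m'"
    using m0(1) m'(1) p0 by (simp_all add: field_simps)
  moreover have "m' \<le> n"
  proof -
    have "real m' \<le> real n" using m'x n xxx xx x by linarith
    then show ?thesis by simp
  qed
  moreover have half: "real (3 * m' + 4 * D * m0) \<le> real r / 2"
  proof -
    have "3 * real m' + 4 * (real D * real m0) \<le> real r / 2"
      using m'x Dm0 r(1) t(1) xD xx x unfolding tD by linarith
    then show ?thesis by simp
  qed
  moreover have "real (4 * D * m0 + 7) * L \<le> p\<^sup>2 * (real r / 2)"
  proof -
    have "w / 200 \<le> real r / 2"
      using r(1) t(1) xD xx x unfolding tD by linarith
    then have "x ^ 3 / (200 * real D) \<le> real r / 2" by (simp add: w_def)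
    moreover have "(real D * L / x)\<^sup>2 \<le> p\<^sup>2" using p(1) pos x0 by (intro power_mono) auto
    ultimately have "(real D * L / x)\<^sup>2 * (x ^ 3 / (200 * real D)) \<le> p\<^sup>2 * (real r / 2)"
      using x0 by (intro mult_mono) auto
    moreover have "(real D * L / x)\<^sup>2 * (x ^ 3 / (200 * real D)) = real D * L * x / 200 * L"
      using x0 D100 by (simp add: field_simps power2_eq_square power3_eq_cube)
    \<comment> \<open>The decisive comparison: after cancelling \<open>L\<close>, at most
      \<open>16 * x + 7\<close> stands against at least \<open>100 * x\<close>, because
      \<open>D * L\<close> is at least 20000.\<close>
    moreover have "real (4 * D * m0 + 7) * L \<le> real D * L * x / 200 * L"
    proof (rule mult_right_mono)
      have "100 * 200 \<le> real D * L" using D100 L by (intro mult_mono) auto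
      then have "100 * 200 * x \<le> real D * L * x" using x0 by (intro mult_right_mono) auto
      moreover have "real (4 * D * m0 + 7) = 4 * (real D * real m0) + 7" by simp
      ultimately show "real (4 * D * m0 + 7) \<le> real D * L * x / 200" using Dm0 x by linarith
    qed (use L in simp)
    ultimately show ?thesis by linarith
  qed
  moreover have "4 * D * t + 3 * t + 2 \<le> n"
  proof -
    have "real D * real t \<le> real D * (x ^ 3 / (20 * real D))" using t(2) by (intro mult_left_mono) auto
    also have "\<dots> = x ^ 3 / 20" using D100 by simp
    finally have "4 * (real D * real t) + 3 * real t + 2 \<le> x ^ 3"
      using t(2) xD' xxx xx x unfolding tD by linarith
    then have "real (4 * D * t + 3 * t + 2) \<le> real n" using n by simp
    then show ?thesis by (simp only: of_nat_le_iff)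
  qed
  moreover have "1 \<le> t"
  proof -
    have "1 \<le> real t" using t(1) xD xx x unfolding tD by linarith
    then show ?thesis by simp
  qed
  ultimately show ?thesis by (rule that)
qed

lemma prob_universal_ge:
  fixes n :: nat and d p :: real
  assumes L: "200 \<le> ln (real n)" and x: "100000 \<le> real n powr (1/3)" and d: "ln (real n) \<le> d"
    and p: "0 \<le> p" "p \<le> 1" "d * real n powr (2/3) * ln (real n) \<le> p * real n"
  shows "1 - 4 / real n \<le> measure_pmf.prob (random_graph n p) {G. universal_for G (bounded_trees n d)}"
proof -
  \<comment> \<open>Degrees are integers, so \<open>d\<close> may be rounded down; halving the
    logarithm absorbs the loss.\<close>
  define D where "D = nat \<lfloor>d\<rfloor>"
  have D: "real D \<le> d" "ln (real n) / 2 \<le> real D" using d L unfolding D_def by linarith+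
  have n0: "0 < real n" using L by (cases n) auto
  have "real D * ln (real n) / real n powr (1/3) \<le> p"
  proof -
    have "real D * ln (real n) * real n powr (2/3) \<le> d * ln (real n) * real n powr (2/3)"
      using D L by (intro mult_right_mono) auto
    also have "\<dots> \<le> p * real n" using p(3) by (simp add: algebra_simps)
    also have "\<dots> = p * (real n powr (1/3) * real n powr (2/3))" using n0 by (simp add: powr_add[symmetric])
    finally have "real D * ln (real n) * real n powr (2/3) \<le> p * real n powr (1/3) * real n powr (2/3)"
      by (simp add: algebra_simps)
    then have "real D * ln (real n) \<le> p * real n powr (1/3)" using n0 by (simp add: mult_le_cancel_right)
    then show ?thesis using n0 by (simp add: field_simps)
  qed
  from parameters_exist[OF L x D(2) this p(2)] obtain m0 m' t r where
    par: "expander_parameters n D m0 m' t r" and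
    bounds: "3 * ln (real n) \<le> p * real m0" "4 * ln (real n) \<le> p\<^sup>2 * real m'" "m' \<le> n"
    "real (3 * m' + 4 * D * m0) \<le> real r / 2" "real (4 * D * m0 + 7) * ln (real n) \<le> p\<^sup>2 * (real r / 2)"
    and size: "4 * D * t + 3 * t + 2 \<le> n" "1 \<le> t" by metis
  interpret expander_parameters n D m0 m' t r by (rule par)
  let ?U = "{G. universal_for G (bounded_trees n d)}"
  \<comment> \<open>Only on the support is the vertex set known to be \<open>{..<n}\<close>.\<close>
  have "(UNIV - failure) \<inter> set_pmf (random_graph n p) \<subseteq> ?U"
  proof
    fix G assume G: "G \<in> (UNIV - failure) \<inter> set_pmf (random_graph n p)"
    have "verts G = {..<n}" using G by (auto simp: random_graph_def)
    then have GE: "G = ({..<n}, edges G)" by (simp add: prod_eq_iff)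
    have ex: "pair_expander n D (2 * m0) m' t (edges G) {..<t + 2 * m0}
        {2 * (t + 2 * m0)..<2 * (t + 2 * m0) + r} (\<lambda>a. a + (t + 2 * m0))"
      using not_failure_imp_pair_expander[of G] G by simp
    have "contains_copy G T" if T: "T \<in> bounded_trees n d" for T
    proof -
      have "is_tree T" "card (verts T) = n" "real (max_degree T) \<le> d" using T by (auto simp: bounded_trees_def)
      moreover from this have "max_degree T \<le> D" unfolding D_def by (simp add: le_nat_floor)
      ultimately have "contains_copy ({..<n}, edges G) T"
        using pair_expander.contains_bounded_tree[OF ex] size by blast
      then show ?thesis using GE by simp
    qed
    then show "G \<in> ?U" by (simp add: universal_for_def)
  qed
  then have "measure_pmf.prob (random_graph n p) ((UNIV - failure) \<inter> set_pmf (random_graph n p))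
      \<le> measure_pmf.prob (random_graph n p) ?U"
    by (intro measure_pmf.finite_measure_mono) auto
  moreover have "measure_pmf.prob (random_graph n p) (UNIV - failure)
      = 1 - measure_pmf.prob (random_graph n p) failure"
    using measure_pmf.prob_compl[of failure "random_graph n p"] by simp
  ultimately show ?thesis
    using prob_failure_le[OF p(1,2) bounds] by (simp add: measure_Int_set_pmf)
qed

theorem theorem2p3:
  shows "\<exists>c::real. c > 0 \<and>
    (\<forall>(\<Delta> :: nat \<Rightarrow> real) (p :: nat \<Rightarrow> real).
       (\<forall>n. \<Delta> n > 0) \<longrightarrow>
       (\<forall>n\<ge>1. \<Delta> n \<ge> ln (real n)) \<longrightarrow>
       (\<forall>n. 0 \<le> p n \<and> p n \<le> 1) \<longrightarrow>
       (\<forall>\<^sub>F n in sequentially. p n * real n \<ge> c * \<Delta> n * real n powr (2/3) * ln (real n)) \<longrightarrow>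
       asymptotically_almost_surely (\<lambda>n. random_graph n (p n))
         (\<lambda>n G. universal_for G (bounded_trees n (\<Delta> n))))"
proof (intro exI[of _ 1] conjI allI impI)
  fix \<Delta> p :: "nat \<Rightarrow> real"
  assume \<Delta>: "\<forall>n\<ge>1. \<Delta> n \<ge> ln (real n)" and p: "\<forall>n. 0 \<le> p n \<and> p n \<le> 1"
    and pn: "\<forall>\<^sub>F n in sequentially. p n * real n \<ge> 1 * \<Delta> n * real n powr (2/3) * ln (real n)"
  let ?P = "\<lambda>n. measure_pmf.prob (random_graph n (p n)) {G. universal_for G (bounded_trees n (\<Delta> n))}"
  \<comment> \<open>The choice \<open>c = 1\<close> suffices because these two bounds, together with
    \<open>\<Delta> n \<ge> ln (real n)\<close>, absorb all absolute constants for large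
    \<open>n\<close>.\<close>
  have "\<forall>\<^sub>F n in sequentially. 200 \<le> ln (real n)" by real_asymp
  moreover have "\<forall>\<^sub>F n in sequentially. 100000 \<le> real n powr (1/3)" by real_asymp
  ultimately have "\<forall>\<^sub>F n in sequentially. 1 - 4 / real n \<le> ?P n"
    using pn eventually_ge_at_top[of 1]
  proof eventually_elim
    case (elim n)
    then show ?case using \<Delta> p by (intro prob_universal_ge) auto
  qed
  moreover have "(\<lambda>n. 1 - 4 / real n) \<longlonglongrightarrow> 1" by real_asymp
  ultimately have "?P \<longlonglongrightarrow> 1"
    by (intro tendsto_sandwich[of "\<lambda>n. 1 - 4 / real n" ?P sequentially "\<lambda>_. 1"]) auto
  then show "asymptotically_almost_surely (\<lambda>n. random_graph n (p n))
      (\<lambda>n G. universal_for G (bounded_trees n (\<Delta> n)))"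
    by (simp add: asymptotically_almost_surely_def)
qed simp

end
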